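(* Let $\mathcal{E}$ be a Gaussian white noise with variance parameter $\sigma^2$. The representation of a solution to the equation $$\left(\mu-\frac{d^2}{dt^2}\right)^{\beta}X(t)=\mathcal{E}(t),\qquad t\ge 0,\ \mu>0,\ \beta>0,$$ can be written as $$X(t)=\frac{1}{\Gamma(\beta)}\int_0^\infty w^{\beta-1}e^{-\mu w}\int_{-\infty}^{+\infty}u_2(x,w)\,\mathcal{E}(t+x)\,dx\,dw,\qquad \beta>0,\ \mu>0,$$ where $u_2(x,w)=\frac{e^{-\frac{x^2}{4w}}}{\sqrt{4\pi w}}$. Moreover, the spectral function of the solution $X$ reads $$f(\tau)=\frac{\sigma^2}{(\mu+\tau^2)^{2\beta}}$$ and the corresponding covariance function has the form $$\mathrm{Cov}_X(h)=\frac{\sigma^2}{\mu^{2\beta}}\,\mathbb{E}\left[\frac{e^{-\frac{h^2}{4W_{2\beta}}}}{2\sqrt{\pi W_{2\beta}}}\right]=\frac{2\sigma^2}{\Gamma(2\beta)}\left(\frac{|h|}{2\sqrt{\mu}}\right)^{2\beta}K_{2\beta}\left(|h|\sqrt{\mu}\right),$$ where $W_{2\beta}$ is a gamma random variable with parameters $\mu$, $2\beta$.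
   Context: The function $u_2(x,w)$, $x\in\mathbb{R}$, $w>0$, is the fundamental solution of the heat equation $\frac{\partial u}{\partial w}=\frac{\partial^2 u}{\partial x^2}$. $K_\nu$ is the modified Bessel function (of the second kind) of index $\nu$. The gamma random variable $W_{2\beta}$ with parameters $\mu$, $2\beta$ has density $\frac{\mu^{2\beta}}{\Gamma(2\beta)}w^{2\beta-1}e^{-\mu w}$, $w>0$. The Gaussian white noise $\mathcal{E}$ is centered, with $\mathbb{E}\,\mathcal{E}(t)\mathcal{E}(s)$ equal to $\sigma^2$ for $t=s$ and $0$ for $t\neq s$, used in integrals as $\mathbb{E}\,\mathcal{E}(t)\mathcal{E}(s)=\sigma^2\delta(t-s)$ with $\delta$ the Dirac delta. The solution is understood formally as $$X(t)=\left(\mu-\frac{d^2}{dt^2}\right)^{-\beta}\mathcal{E}(t)=\frac{1}{\Gamma(\beta)}\int_0^\infty w^{\beta-1}e^{-\mu w}\,e^{w\frac{d^2}{dt^2}}\mathcal{E}(t)\,dw,$$ where $e^{w\frac{d^2}{dt^2}}=\int_{-\infty}^{\infty}u_2(x,w)\,e^{x\frac{d}{dt}}\,dx$ and $e^{x\frac{d}{dt}}\mathcal{E}(t)=\mathcal{E}(t+x)$. The covariance function is $\mathrm{Cov}_X(h)=\mathbb{E}[X(t+h)X(t)]$, with $\mathbb{E}X(t)=0$, and the spectral function is its Fourier transform $f(\tau)=\int_{-\infty}^{+\infty}e^{i\tau h}\,\mathrm{Cov}_X(h)\,dh$, $\tau\in\mathbb{R}$.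
   Formalization: The Bessel formula is corrected to σ²/(√π Γ(2β)) (|h|/(2√μ))^{2β−1/2} K_{2β−1/2}(|h|√μ), h≠0 (as a limit at 0 if β>1/4); for β≤1/4, where X(t) has infinite variance, representation and covariance are for X as a generalized process, with no value at h=0. *)

theory Defs
  imports "HOL-Probability.Probability"
begin

definition L2 :: "'a measure \<Rightarrow> ('a \<Rightarrow> real) set" where
  "L2 M = {Z \<in> borel_measurable M. integrable M (\<lambda>\<omega>. (Z \<omega>)\<^sup>2)}"

definition centered_gaussian :: "'a measure \<Rightarrow> ('a \<Rightarrow> real) \<Rightarrow> bool" where
  "centered_gaussian M Z \<longleftrightarrow>
     Z \<in> borel_measurable M \<and>
     ((AE \<omega> in M. Z \<omega> = 0) \<or> (\<exists>s>0. distributed M lborel Z (normal_density 0 s)))"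

text \<open>
  White noise has no values at points, so it is given through its integrals:
  \<open>E \<phi>\<close> stands for \<open>\<integral> \<phi>(s) E(s) ds\<close>, for every square-integrable \<open>\<phi>\<close>. The covariance
  \<open>\<sigma>\<^sup>2 \<delta>(t - s)\<close> becomes \<open>\<sigma>\<^sup>2 \<integral> \<phi>(s) \<psi>(s) ds\<close>. The last clause is joint Gaussianity.
  Linearity of \<open>E\<close> (almost surely) follows from the covariance.
\<close>

definition gaussian_white_noise ::
  "'a measure \<Rightarrow> real \<Rightarrow> ((real \<Rightarrow> real) \<Rightarrow> 'a \<Rightarrow> real) \<Rightarrow> bool" where
  "gaussian_white_noise M \<sigma> E \<longleftrightarrow>
     prob_space M \<and>
     (\<forall>\<phi>\<in>L2 lborel. E \<phi> \<in> L2 M \<and> (\<integral>\<omega>. E \<phi> \<omega> \<partial>M) = 0) \<and>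
     (\<forall>\<phi>\<in>L2 lborel. \<forall>\<psi>\<in>L2 lborel.
        (\<integral>\<omega>. E \<phi> \<omega> * E \<psi> \<omega> \<partial>M) = \<sigma>\<^sup>2 * (\<integral>s. \<phi> s * \<psi> s \<partial>lborel)) \<and>
     (\<forall>F a. finite F \<and> F \<subseteq> L2 lborel \<longrightarrow>
        centered_gaussian M (\<lambda>\<omega>. \<Sum>\<phi>\<in>F. a \<phi> * E \<phi> \<omega>))"

text \<open>
  \<open>has_ms_integral M A Y Z\<close>: the random variable \<open>Z\<close> is the mean-square integral
  \<open>\<integral>\<^sub>A Y(w) dw\<close>, that is, the weak (Pettis) integral in \<open>L\<^sup>2(M)\<close>. It determines \<open>Z\<close> up to
  null sets.
\<close>

definition has_ms_integral ::
  "'a measure \<Rightarrow> real set \<Rightarrow> (real \<Rightarrow> 'a \<Rightarrow> real) \<Rightarrow> ('a \<Rightarrow> real) \<Rightarrow> bool" where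
  "has_ms_integral M A Y Z \<longleftrightarrow>
     Z \<in> L2 M \<and> (\<forall>w\<in>A. Y w \<in> L2 M) \<and>
     (\<forall>V\<in>L2 M.
        set_integrable lborel A (\<lambda>w. \<integral>\<omega>. Y w \<omega> * V \<omega> \<partial>M) \<and>
        (\<integral>\<omega>. Z \<omega> * V \<omega> \<partial>M) = (LINT w:A|lborel. (\<integral>\<omega>. Y w \<omega> * V \<omega> \<partial>M)))"

definition heat_kernel :: "real \<Rightarrow> real \<Rightarrow> real" where
  "heat_kernel x w = exp (- (x\<^sup>2) / (4 * w)) / sqrt (4 * pi * w)"

definition test_functions :: "(real \<Rightarrow> real) set" where
  "test_functions = {\<phi>. continuous_on UNIV \<phi> \<and> (\<exists>R. \<forall>x. \<bar>x\<bar> > R \<longrightarrow> \<phi> x = 0)}"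

text \<open>
  A generalized process \<open>Z\<close> is given by \<open>Z \<phi> = \<integral> \<phi>(s) Z(s) ds\<close>. The operator
  \<open>exp(x d/dt)\<close> maps \<open>Z(t)\<close> to \<open>Z(t + x)\<close>, hence
  \<open>shift x Z \<phi> = \<integral> \<phi>(t) Z(t + x) dt = \<integral> \<phi>(s - x) Z(s) ds\<close>.
\<close>

definition shift ::
  "real \<Rightarrow> ((real \<Rightarrow> real) \<Rightarrow> 'a \<Rightarrow> real) \<Rightarrow> ((real \<Rightarrow> real) \<Rightarrow> 'a \<Rightarrow> real)" where
  "shift x Z \<phi> = Z (\<lambda>s. \<phi> (s - x))"

text \<open>\<open>Y = exp(w d\<^sup>2/dt\<^sup>2) Z = \<integral> heat_kernel x w exp(x d/dt) Z dx\<close>, tested against every \<open>\<phi>\<close>.\<close>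

definition is_heat_semigroup ::
  "'a measure \<Rightarrow> real \<Rightarrow> ((real \<Rightarrow> real) \<Rightarrow> 'a \<Rightarrow> real) \<Rightarrow> ((real \<Rightarrow> real) \<Rightarrow> 'a \<Rightarrow> real) \<Rightarrow> bool" where
  "is_heat_semigroup M w Z Y \<longleftrightarrow>
     (\<forall>\<phi>\<in>test_functions.
        has_ms_integral M UNIV (\<lambda>x \<omega>. heat_kernel x w * shift x Z \<phi> \<omega>) (Y \<phi>))"

text \<open>
  \<open>X\<close> solves \<open>(\<mu> - d\<^sup>2/dt\<^sup>2)\<^sup>\<beta> X = E\<close> in the sense that
  \<open>X = (\<mu> - d\<^sup>2/dt\<^sup>2)\<^sup>-\<^sup>\<beta> E = 1/\<Gamma>(\<beta>) \<integral>\<^sub>0\<^sup>\<infinity> w\<^sup>\<beta>\<^sup>-\<^sup>1 exp(-\<mu> w) exp(w d\<^sup>2/dt\<^sup>2) E dw\<close>.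
  The process is a generalized one, because for \<open>\<beta> \<le> 1/4\<close> the solution has no values at points.
\<close>

definition is_solution ::
  "'a measure \<Rightarrow> real \<Rightarrow> real \<Rightarrow> ((real \<Rightarrow> real) \<Rightarrow> 'a \<Rightarrow> real) \<Rightarrow> ((real \<Rightarrow> real) \<Rightarrow> 'a \<Rightarrow> real) \<Rightarrow> bool" where
  "is_solution M \<mu> \<beta> E X \<longleftrightarrow>
     (\<exists>Y. (\<forall>w>0. is_heat_semigroup M w E (Y w)) \<and>
          (\<forall>\<phi>\<in>test_functions.
             has_ms_integral M {0<..}
               (\<lambda>w \<omega>. 1 / Gamma \<beta> * (w powr (\<beta> - 1) * exp (- \<mu> * w) * Y w \<phi> \<omega>)) (X \<phi>)))"

text \<open>
  \<open>Z = 1/\<Gamma>(\<beta>) \<integral>\<^sub>0\<^sup>\<infinity> w\<^sup>\<beta>\<^sup>-\<^sup>1 exp(-\<mu> w) \<integral> heat_kernel x w E(t + x) dx dw\<close>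
  at the point \<open>t\<close>. The inner integral is \<open>shift t E\<close> applied to \<open>\<lambda>x. heat_kernel x w\<close>.
\<close>

definition represented_at ::
  "'a measure \<Rightarrow> real \<Rightarrow> real \<Rightarrow> ((real \<Rightarrow> real) \<Rightarrow> 'a \<Rightarrow> real) \<Rightarrow> real \<Rightarrow> ('a \<Rightarrow> real) \<Rightarrow> bool" where
  "represented_at M \<mu> \<beta> E t Z \<longleftrightarrow>
     has_ms_integral M {0<..}
       (\<lambda>w \<omega>. 1 / Gamma \<beta> * (w powr (\<beta> - 1) * exp (- \<mu> * w) * shift t E (\<lambda>x. heat_kernel x w) \<omega>)) Z"

text \<open>
  The same formula as an identity of generalized processes: both sides are multiplied by \<open>\<phi>(t)\<close>
  and integrated over \<open>t\<close>, the \<open>t\<close>-integral being carried out under the \<open>w\<close>-integral.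
\<close>

definition represented_weakly ::
  "'a measure \<Rightarrow> real \<Rightarrow> real \<Rightarrow> ((real \<Rightarrow> real) \<Rightarrow> 'a \<Rightarrow> real) \<Rightarrow> (real \<Rightarrow> real) \<Rightarrow> ('a \<Rightarrow> real) \<Rightarrow> bool" where
  "represented_weakly M \<mu> \<beta> E \<phi> Z \<longleftrightarrow>
     (\<exists>Y. (\<forall>w>0. has_ms_integral M UNIV
                   (\<lambda>t \<omega>. \<phi> t * shift t E (\<lambda>x. heat_kernel x w) \<omega>) (Y w)) \<and>
          has_ms_integral M {0<..}
            (\<lambda>w \<omega>. 1 / Gamma \<beta> * (w powr (\<beta> - 1) * exp (- \<mu> * w) * Y w \<omega>)) Z)"

text \<open>\<open>E[X(t + h) X(t)] = C h\<close> and \<open>E X(t) = 0\<close>, for a process with values at points.\<close>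

definition has_covariance :: "'a measure \<Rightarrow> (real \<Rightarrow> 'a \<Rightarrow> real) \<Rightarrow> (real \<Rightarrow> real) \<Rightarrow> bool" where
  "has_covariance M X C \<longleftrightarrow>
     (\<forall>t. X t \<in> L2 M \<and> (\<integral>\<omega>. X t \<omega> \<partial>M) = 0) \<and>
     (\<forall>t h. (\<integral>\<omega>. X (t + h) \<omega> * X t \<omega> \<partial>M) = C h)"

text \<open>
  The same for a generalized process, in the sense in which white noise has covariance
  \<open>\<sigma>\<^sup>2 \<delta>(t - s)\<close>.
\<close>

definition has_generalized_covariance ::
  "'a measure \<Rightarrow> ((real \<Rightarrow> real) \<Rightarrow> 'a \<Rightarrow> real) \<Rightarrow> (real \<Rightarrow> real) \<Rightarrow> bool" where
  "has_generalized_covariance M X C \<longleftrightarrow>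
     (\<forall>\<phi>\<in>test_functions. X \<phi> \<in> L2 M \<and> (\<integral>\<omega>. X \<phi> \<omega> \<partial>M) = 0) \<and>
     (\<forall>\<phi>\<in>test_functions. \<forall>\<psi>\<in>test_functions.
        integrable (lborel \<Otimes>\<^sub>M lborel) (\<lambda>(t, s). \<phi> t * \<psi> s * C (t - s)) \<and>
        (\<integral>\<omega>. X \<phi> \<omega> * X \<psi> \<omega> \<partial>M) =
          (\<integral>(t, s). \<phi> t * \<psi> s * C (t - s) \<partial>(lborel \<Otimes>\<^sub>M lborel)))"

definition spectral_function :: "(real \<Rightarrow> real) \<Rightarrow> real \<Rightarrow> complex" where
  "spectral_function C \<tau> = (\<integral>h. exp (\<i> * complex_of_real (\<tau> * h)) * complex_of_real (C h) \<partial>lborel)"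

definition gamma_density :: "real \<Rightarrow> real \<Rightarrow> real \<Rightarrow> real" where
  "gamma_density \<mu> a w =
     (if w > 0 then \<mu> powr a / Gamma a * w powr (a - 1) * exp (- \<mu> * w) else 0)"

text \<open>
  The modified Bessel function of the second kind for real index \<open>\<nu>\<close> and argument \<open>z > 0\<close>,
  by its integral representation (DLMF 10.32.9). The integral diverges for \<open>z \<le> 0\<close>.
\<close>

definition bessel_K :: "real \<Rightarrow> real \<Rightarrow> real" where
  "bessel_K \<nu> z = (LINT t:{0..}|lborel. exp (- z * cosh t) * cosh (\<nu> * t))"

end

theory Submission
  imports Defs
begin

text \<open>
  White noise enters through the map \<open>E\<close> from \<open>L\<^sup>2(\<real>)\<close> to \<open>L\<^sup>2(M)\<close>, which multiplies inner
  products by \<open>\<sigma>\<^sup>2\<close> and is therefore linear almost surely. The central fact is that \<open>E\<close> commutes with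
  integration: if the functions \<open>k w\<close> have integrable \<open>L\<^sup>2\<close> norms, then the mean-square integral of
  \<open>E (k w)\<close> is \<open>E\<close> of the integral of \<open>k w\<close> (\<open>white_noise_ms_integral\<close>). For a random variable \<open>V\<close>
  this says that the bounded functional \<open>\<phi> \<mapsto> \<integral> E \<phi> \<cdot> V\<close> may be applied under the integral sign.
  Up to an arbitrarily small error in operator norm the functional is an inner product
  (\<open>approximate_Riesz_representation\<close>), and for inner products the claim is Fubini's theorem.

  Every process in the theorem is thus \<open>E\<close> of an explicit function. The heat semigroup moves from
  the noise to the test function, and the solution is \<open>X \<phi> = E ((\<mu> - d\<^sup>2/dt\<^sup>2)\<^sup>-\<^sup>\<beta> \<phi>)\<close>, with the Bessel
  potential of \<open>\<phi>\<close> as the argument. Mean-square integrals are unique almost surely, so every solution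
  has this form. The value at a point \<open>t\<close> is \<open>E\<close> of the Bessel potential kernel centred at \<open>t\<close>. The
  heat kernel at time \<open>w\<close> has norm \<open>c w\<^sup>-\<^sup>1\<^sup>/\<^sup>4\<close>, and \<open>w\<^sup>\<beta>\<^sup>-\<^sup>1 w\<^sup>-\<^sup>1\<^sup>/\<^sup>4\<close> is integrable near \<open>0\<close> exactly for
  \<open>\<beta> > 1/4\<close>.

  For the covariance, two heat kernels at times \<open>w\<close> and \<open>w'\<close> centred at \<open>t\<close> and \<open>t'\<close> have inner product
  equal to the heat kernel at time \<open>w + w'\<close> and distance \<open>t - t'\<close> (\<open>heat_kernel_semigroup\<close>). Averaging
  over independent gamma times \<open>w\<close> and \<open>w'\<close> of shape \<open>\<beta>\<close> is the same as averaging over one gamma time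
  \<open>w + w'\<close> of shape \<open>2\<beta>\<close> (\<open>gamma_weight_convolution\<close>). Hence the covariance is \<open>\<sigma>\<^sup>2\<close> times the Bessel
  potential kernel of exponent \<open>2\<beta>\<close>, a gamma mixture of heat kernels. The three formulas for it are
  the mixture written as an expectation; its Fourier transform, which is the Laplace transform of the
  gamma weight at \<open>\<tau>\<^sup>2\<close>; and the substitution \<open>w = (\<bar>h\<bar> / (2 \<surd>\<mu>)) e\<^sup>t\<close>, which produces the
  integral representation of the Bessel function.
\<close>

section \<open>Square-integrable functions\<close>

definition norm2 :: "'a measure \<Rightarrow> ('a \<Rightarrow> real) \<Rightarrow> real" where
  "norm2 M f = sqrt (\<integral>x. (f x)\<^sup>2 \<partial>M)"

lemma L2_measurable [measurable_dest]: "f \<in> L2 M \<Longrightarrow> f \<in> borel_measurable M"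
  by (simp add: L2_def)

lemma L2_square_integrable: "f \<in> L2 M \<Longrightarrow> integrable M (\<lambda>x. (f x)\<^sup>2)"
  by (simp add: L2_def)

lemma norm2_nonneg [simp]: "norm2 M f \<ge> 0"
  by (simp add: norm2_def)

lemma norm2_squared: "(norm2 M f)\<^sup>2 = (\<integral>x. (f x)\<^sup>2 \<partial>M)"
  by (simp add: norm2_def)

lemma L2_integrable_mult:
  assumes "f \<in> L2 M" "g \<in> L2 M"
  shows "integrable M (\<lambda>x. f x * g x)"
proof (rule Bochner_Integration.integrable_bound)
  show "integrable M (\<lambda>x. (f x)\<^sup>2 + (g x)\<^sup>2)"
    using assms by (simp add: L2_square_integrable)
  show "(\<lambda>x. f x * g x) \<in> borel_measurable M"
    using assms by measurable
  have "\<bar>a * b\<bar> \<le> a\<^sup>2 + b\<^sup>2" for a b :: real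
  proof -
    have "0 \<le> \<bar>a\<bar> * \<bar>b\<bar>" "2 * \<bar>a\<bar> * \<bar>b\<bar> \<le> a\<^sup>2 + b\<^sup>2"
      using sum_squares_bound[of "\<bar>a\<bar>" "\<bar>b\<bar>"] by simp_all
    then show ?thesis
      unfolding abs_mult by linarith
  qed
  then show "AE x in M. norm (f x * g x) \<le> norm ((f x)\<^sup>2 + (g x)\<^sup>2)"
    by simp
qed

lemma L2_linear_combination:
  assumes "f \<in> L2 M" "g \<in> L2 M"
  shows "(\<lambda>x. a * f x + b * g x) \<in> L2 M"
proof -
  have "integrable M (\<lambda>x. a\<^sup>2 * (f x)\<^sup>2 + 2 * a * b * (f x * g x) + b\<^sup>2 * (g x)\<^sup>2)"
    using L2_square_integrable[OF assms(1)] L2_square_integrable[OF assms(2)] L2_integrable_mult[OF assms]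
    by (intro Bochner_Integration.integrable_add integrable_mult_right)
  moreover have "(\<lambda>x. a\<^sup>2 * (f x)\<^sup>2 + 2 * a * b * (f x * g x) + b\<^sup>2 * (g x)\<^sup>2) = (\<lambda>x. (a * f x + b * g x)\<^sup>2)"
    by (intro ext) (simp add: power2_eq_square algebra_simps)
  moreover have "(\<lambda>x. a * f x + b * g x) \<in> borel_measurable M"
    using assms by measurable
  ultimately show ?thesis
    by (simp add: L2_def)
qed

lemma L2_scale: "f \<in> L2 M \<Longrightarrow> (\<lambda>x. a * f x) \<in> L2 M"
  using L2_linear_combination[of f M f a 0] by simp

lemma norm2_scale: "norm2 M (\<lambda>x. a * f x) = \<bar>a\<bar> * norm2 M f"
  by (simp add: norm2_def power_mult_distrib real_sqrt_mult)

lemma integral_square_linear_combination: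
  assumes "f \<in> L2 M" "g \<in> L2 M"
  shows "(\<integral>x. (a * f x + b * g x)\<^sup>2 \<partial>M) =
    a\<^sup>2 * (\<integral>x. (f x)\<^sup>2 \<partial>M) + 2 * a * b * (\<integral>x. f x * g x \<partial>M) + b\<^sup>2 * (\<integral>x. (g x)\<^sup>2 \<partial>M)"
proof -
  have "(\<integral>x. (a * f x + b * g x)\<^sup>2 \<partial>M) =
      (\<integral>x. a\<^sup>2 * (f x)\<^sup>2 + 2 * a * b * (f x * g x) + b\<^sup>2 * (g x)\<^sup>2 \<partial>M)"
    by (intro Bochner_Integration.integral_cong) (simp_all add: power2_eq_square algebra_simps)
  also have "\<dots> = a\<^sup>2 * (\<integral>x. (f x)\<^sup>2 \<partial>M) + 2 * a * b * (\<integral>x. f x * g x \<partial>M) + b\<^sup>2 * (\<integral>x. (g x)\<^sup>2 \<partial>M)"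
    using L2_square_integrable[OF assms(1)] L2_square_integrable[OF assms(2)] L2_integrable_mult[OF assms]
    by (simp add: Bochner_Integration.integral_add)
  finally show ?thesis .
qed

lemma nonneg_quadratic_discriminant:
  fixes a b c :: real
  assumes "\<And>t. a * t\<^sup>2 + 2 * b * t + c \<ge> 0" "a \<ge> 0"
  shows "b\<^sup>2 \<le> a * c"
proof (cases "a = 0")
  case True
  have "b = 0"
  proof (rule ccontr)
    assume "b \<noteq> 0"
    then show False
      (* At this point the affine function takes the value -1. *)
      using assms(1)[of "- (c + 1) / (2 * b)"] True by simp
  qed
  then show ?thesis using True by simp
next
  case False
  then have "a > 0" using assms(2) by simp
  have "0 \<le> a * (a * (- b / a)\<^sup>2 + 2 * b * (- b / a) + c)"
    using assms(1)[of "- b / a"] \<open>a > 0\<close> by (intro mult_nonneg_nonneg) auto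
  also have "\<dots> = a * c - b\<^sup>2"
    using \<open>a > 0\<close> by (simp add: field_simps power2_eq_square)
  finally show ?thesis by simp
qed

text \<open>
  The quadratic polynomial \<open>t \<mapsto> \<integral> (t f + g)\<^sup>2\<close> is nonnegative, so its discriminant is not positive.
\<close>

lemma L2_Cauchy_Schwarz:
  assumes "f \<in> L2 M" "g \<in> L2 M"
  shows "\<bar>\<integral>x. f x * g x \<partial>M\<bar> \<le> norm2 M f * norm2 M g"
proof -
  have "(norm2 M f)\<^sup>2 * t\<^sup>2 + 2 * (\<integral>x. f x * g x \<partial>M) * t + (norm2 M g)\<^sup>2 \<ge> 0" for t
  proof -
    have "0 \<le> (\<integral>x. (t * f x + 1 * g x)\<^sup>2 \<partial>M)"
      by simp
    also have "\<dots> = (norm2 M f)\<^sup>2 * t\<^sup>2 + 2 * (\<integral>x. f x * g x \<partial>M) * t + (norm2 M g)\<^sup>2"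
      by (subst integral_square_linear_combination[OF assms]) (simp add: norm2_squared mult_ac)
    finally show ?thesis .
  qed
  then have "(\<integral>x. f x * g x \<partial>M)\<^sup>2 \<le> (norm2 M f)\<^sup>2 * (norm2 M g)\<^sup>2"
    by (rule nonneg_quadratic_discriminant) simp
  then have "\<bar>\<integral>x. f x * g x \<partial>M\<bar>\<^sup>2 \<le> (norm2 M f * norm2 M g)\<^sup>2"
    by (simp add: power_mult_distrib)
  then show ?thesis
    by (rule power2_le_imp_le) simp
qed

lemma L2_abs: "f \<in> L2 M \<Longrightarrow> (\<lambda>x. \<bar>f x\<bar>) \<in> L2 M"
  by (auto simp: L2_def)

lemma norm2_abs: "norm2 M (\<lambda>x. \<bar>f x\<bar>) = norm2 M f"
  by (simp add: norm2_def)

text \<open>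
  The functional \<open>J f = \<parallel>f\<parallel>\<^sup>2 - 2 l f\<close> is bounded below by \<open>-C\<^sup>2\<close>. An exact minimizer would represent \<open>l\<close>;
  here \<open>v\<close> is a function whose value \<open>J v\<close> exceeds the infimum by less than \<open>\<epsilon>\<^sup>2\<close>. Moving from \<open>v\<close> in the
  direction \<open>f\<close> cannot lower \<open>J\<close> by more than \<open>\<epsilon>\<^sup>2\<close>, and the discriminant of the resulting quadratic
  polynomial bounds the error at \<open>f\<close>, uniformly on the unit ball.
\<close>

lemma approximate_Riesz_representation:
  fixes l :: "('a \<Rightarrow> real) \<Rightarrow> real"
  assumes linear: "\<And>f g t. f \<in> L2 M \<Longrightarrow> g \<in> L2 M \<Longrightarrow> l (\<lambda>x. f x + t * g x) = l f + t * l g"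
    and bounded: "\<And>f. f \<in> L2 M \<Longrightarrow> \<bar>l f\<bar> \<le> C * norm2 M f"
    and "\<epsilon> > 0"
  shows "\<exists>v\<in>L2 M. \<forall>f\<in>L2 M. \<bar>(\<integral>x. v x * f x \<partial>M) - l f\<bar> \<le> \<epsilon> * norm2 M f"
proof -
  define J where "J f = (norm2 M f)\<^sup>2 - 2 * l f" for f
  have "J f \<ge> - C\<^sup>2" if "f \<in> L2 M" for f
  proof -
    have "0 \<le> (norm2 M f - C)\<^sup>2" by simp
    then show ?thesis
      using bounded[OF that] by (simp add: J_def power2_eq_square algebra_simps)
  qed
  then have bdd: "bdd_below (J ` L2 M)"
    by (auto intro!: bdd_belowI)
  have "(\<lambda>x. 0) \<in> L2 M"
    by (simp add: L2_def)
  then have "\<exists>y\<in>J ` L2 M. y < Inf (J ` L2 M) + \<epsilon>\<^sup>2"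
    using \<open>\<epsilon> > 0\<close> by (intro cInf_lessD) auto
  then obtain v where v: "v \<in> L2 M" "J v < Inf (J ` L2 M) + \<epsilon>\<^sup>2"
    by auto
  have "\<bar>(\<integral>x. v x * f x \<partial>M) - l f\<bar> \<le> \<epsilon> * norm2 M f" if f: "f \<in> L2 M" for f
  proof -
    define b where "b = (\<integral>x. v x * f x \<partial>M) - l f"
    have "(norm2 M f)\<^sup>2 * t\<^sup>2 + 2 * b * t + \<epsilon>\<^sup>2 \<ge> 0" for t
    proof -
      have "(\<lambda>x. v x + t * f x) \<in> L2 M"
        using L2_linear_combination[OF v(1) f, of 1 t] by simp
      then have "Inf (J ` L2 M) \<le> J (\<lambda>x. v x + t * f x)"
        using bdd by (intro cInf_lower) auto
      also have "\<dots> = J v + t\<^sup>2 * (norm2 M f)\<^sup>2 + 2 * t * b"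
        using integral_square_linear_combination[OF v(1) f, of 1 t]
        by (simp add: J_def b_def norm2_squared linear[OF v(1) f] algebra_simps)
      finally show ?thesis
        using v(2) by (simp add: mult_ac)
    qed
    then have "b\<^sup>2 \<le> (norm2 M f)\<^sup>2 * \<epsilon>\<^sup>2"
      by (rule nonneg_quadratic_discriminant) simp
    then have "\<bar>b\<bar>\<^sup>2 \<le> (\<epsilon> * norm2 M f)\<^sup>2"
      by (simp add: power_mult_distrib mult_ac)
    then show ?thesis
      unfolding b_def[symmetric] by (rule power2_le_imp_le) (use \<open>\<epsilon> > 0\<close> in simp)
  qed
  with v(1) show ?thesis by blast
qed

text \<open>
  By the Cauchy-Schwarz inequality \<open>v s * k w s\<close> is integrable in both variables, so Fubini's theorem
  applies. These facts precede the square integrability of \<open>\<integral> k w s dw\<close> and are used to prove it.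
\<close>

lemma L2_Minkowski_pairing:
  fixes k :: "'b \<Rightarrow> 'c \<Rightarrow> real"
  assumes "sigma_finite_measure Q" "sigma_finite_measure M"
    and meas [measurable]: "case_prod k \<in> borel_measurable (Q \<Otimes>\<^sub>M M)"
    and L2: "\<And>w. w \<in> space Q \<Longrightarrow> k w \<in> L2 M"
    and int: "integrable Q (\<lambda>w. norm2 M (k w))"
    and v: "v \<in> L2 M"
  shows "integrable Q (\<lambda>w. \<integral>s. v s * k w s \<partial>M)"
    and "integrable M (\<lambda>s. v s * (\<integral>w. k w s \<partial>Q))"
    and "(\<integral>s. v s * (\<integral>w. k w s \<partial>Q) \<partial>M) = (\<integral>w. (\<integral>s. v s * k w s \<partial>M) \<partial>Q)"
    and "\<bar>\<integral>s. v s * (\<integral>w. k w s \<partial>Q) \<partial>M\<bar> \<le> norm2 M v * (\<integral>w. norm2 M (k w) \<partial>Q)"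
proof -
  interpret Q: sigma_finite_measure Q by fact
  interpret M: sigma_finite_measure M by fact
  interpret pair_sigma_finite Q M ..
  have vm [measurable]: "v \<in> borel_measurable M"
    using v by measurable
  have bound: "(\<integral>s. \<bar>v s * k w s\<bar> \<partial>M) \<le> norm2 M v * norm2 M (k w)" if "w \<in> space Q" for w
    using L2_Cauchy_Schwarz[OF L2_abs[OF v] L2_abs[OF L2[OF that]]]
    by (simp add: norm2_abs abs_mult)
  have joint: "integrable (Q \<Otimes>\<^sub>M M) (case_prod (\<lambda>w s. v s * k w s))"
  proof (rule Fubini_integrable)
    show "integrable Q (\<lambda>w. \<integral>s. norm (case (w, s) of (w, s) \<Rightarrow> v s * k w s) \<partial>M)"
    proof (rule Bochner_Integration.integrable_bound)
      show "integrable Q (\<lambda>w. norm2 M v * norm2 M (k w))"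
        using int by simp
      show "AE w in Q. norm (\<integral>s. norm (case (w, s) of (w, s) \<Rightarrow> v s * k w s) \<partial>M)
          \<le> norm (norm2 M v * norm2 M (k w))"
        using bound by (intro AE_I2) (simp add: abs_mult)
    qed measurable
    show "AE w in Q. integrable M (\<lambda>s. case (w, s) of (w, s) \<Rightarrow> v s * k w s)"
      using L2_integrable_mult[OF v L2] by (intro AE_I2) simp
  qed measurable
  show I: "integrable Q (\<lambda>w. \<integral>s. v s * k w s \<partial>M)"
    using integrable_fst[OF joint] .
  show "integrable M (\<lambda>s. v s * (\<integral>w. k w s \<partial>Q))"
    using integrable_snd[OF joint] by simp
  show eq: "(\<integral>s. v s * (\<integral>w. k w s \<partial>Q) \<partial>M) = (\<integral>w. (\<integral>s. v s * k w s \<partial>M) \<partial>Q)"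
    using Fubini_integral[OF joint] by simp
  have "\<bar>\<integral>w. (\<integral>s. v s * k w s \<partial>M) \<partial>Q\<bar> \<le> (\<integral>w. norm2 M v * norm2 M (k w) \<partial>Q)"
  proof (rule order_trans[OF integral_abs_bound integral_mono])
    show "\<bar>\<integral>s. v s * k w s \<partial>M\<bar> \<le> norm2 M v * norm2 M (k w)" if "w \<in> space Q" for w
      using L2_Cauchy_Schwarz[OF v L2[OF that]] .
  qed (use I int in auto)
  then show "\<bar>\<integral>s. v s * (\<integral>w. k w s \<partial>Q) \<partial>M\<bar> \<le> norm2 M v * (\<integral>w. norm2 M (k w) \<partial>Q)"
    by (simp add: eq)
qed

text \<open>
  Minkowski's inequality for integrals, by duality: the function \<open>\<Psi> = \<integral> k w dw\<close> is tested against its own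
  truncations \<open>v i\<close>, for which \<open>\<parallel>v i\<parallel>\<^sup>2 = \<integral> v i \<Psi> \<le> K \<parallel>v i\<parallel>\<close> with \<open>K = \<integral> \<parallel>k w\<parallel> dw\<close>. Hence \<open>\<parallel>v i\<parallel> \<le> K\<close>, and
  the bound passes to \<open>\<Psi>\<close> by monotone convergence.
\<close>

lemma L2_Minkowski:
  fixes k :: "'b \<Rightarrow> 'c \<Rightarrow> real"
  assumes "sigma_finite_measure Q" "sigma_finite_measure M"
    and meas [measurable]: "case_prod k \<in> borel_measurable (Q \<Otimes>\<^sub>M M)"
    and L2: "\<And>w. w \<in> space Q \<Longrightarrow> k w \<in> L2 M"
    and int: "integrable Q (\<lambda>w. norm2 M (k w))"
  shows "(\<lambda>s. \<integral>w. k w s \<partial>Q) \<in> L2 M"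
    and "norm2 M (\<lambda>s. \<integral>w. k w s \<partial>Q) \<le> (\<integral>w. norm2 M (k w) \<partial>Q)"
proof -
  interpret Q: sigma_finite_measure Q by fact
  interpret M: sigma_finite_measure M by fact
  interpret pair_sigma_finite Q M ..
  define \<Psi> where "\<Psi> s = (\<integral>w. k w s \<partial>Q)" for s
  define K where "K = (\<integral>w. norm2 M (k w) \<partial>Q)"
  have K: "K \<ge> 0"
    by (simp add: K_def)
  have [measurable]: "\<Psi> \<in> borel_measurable M"
    unfolding \<Psi>_def by measurable
  obtain B :: "nat \<Rightarrow> 'c set" where B: "range B \<subseteq> sets M" "(\<Union>i. B i) = space M"
      "\<And>i. emeasure M (B i) \<noteq> \<infinity>" "incseq B"
    using M.sigma_finite_incseq by blast
  have [measurable]: "B i \<in> sets M" for i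
    using B(1) by auto
  (* The truncation is in the range of \<Psi> and in its domain, so that v i is bounded
     with support of finite measure. *)
  define D where "D i = {s\<in>space M. \<bar>\<Psi> s\<bar> \<le> real i} \<inter> B i" for i
  have [measurable]: "D i \<in> sets M" for i
    unfolding D_def by measurable
  define v where "v i s = indicator (D i) s * \<Psi> s" for i s
  have vL2: "v i \<in> L2 M" for i
  proof -
    have "integrable M (\<lambda>s. (v i s)\<^sup>2)"
    proof (rule Bochner_Integration.integrable_bound)
      show "integrable M (\<lambda>s. (real i)\<^sup>2 * indicator (B i) s)"
        using B(3)[of i] by (simp add: less_top[symmetric])
      show "AE s in M. norm ((v i s)\<^sup>2) \<le> norm ((real i)\<^sup>2 * indicator (B i) s)"
        by (intro AE_I2) (auto simp: v_def D_def indicator_def abs_le_square_iff[symmetric])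
      show "(\<lambda>s. (v i s)\<^sup>2) \<in> borel_measurable M"
        unfolding v_def by measurable
    qed
    then show ?thesis
      by (simp add: L2_def v_def[abs_def])
  qed
  have v_norm: "norm2 M (v i) \<le> K" for i
  proof -
    have "(norm2 M (v i))\<^sup>2 = (\<integral>s. v i s * \<Psi> s \<partial>M)"
      unfolding norm2_squared
      by (intro Bochner_Integration.integral_cong) (auto simp: v_def indicator_def power2_eq_square)
    also have "\<dots> \<le> norm2 M (v i) * K"
      using L2_Minkowski_pairing(4)[OF assms vL2[of i]] by (simp add: \<Psi>_def K_def)
    finally have "norm2 M (v i) * norm2 M (v i) \<le> norm2 M (v i) * K"
      by (simp add: power2_eq_square)
    then show ?thesis
      using K norm2_nonneg[of M "v i"] by (cases "norm2 M (v i) = 0") (auto simp: mult_le_cancel_left)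
  qed
  have "(\<integral>\<^sup>+s. ennreal ((\<Psi> s)\<^sup>2) \<partial>M) = (\<integral>\<^sup>+s. (SUP i. ennreal ((v i s)\<^sup>2)) \<partial>M)"
  proof (rule nn_integral_cong)
    fix s assume s: "s \<in> space M"
    obtain i where i: "s \<in> B i" using s B(2) by auto
    define j where "j = max i (nat \<lceil>\<bar>\<Psi> s\<bar>\<rceil>)"
    have "B i \<subseteq> B j"
      using B(4) by (simp add: incseq_def j_def)
    moreover have "\<bar>\<Psi> s\<bar> \<le> real j"
      unfolding j_def by linarith
    ultimately have "s \<in> D j"
      using s i by (auto simp: D_def)
    then have "ennreal ((\<Psi> s)\<^sup>2) = ennreal ((v j s)\<^sup>2)"
      by (simp add: v_def)
    moreover have "ennreal ((v i s)\<^sup>2) \<le> ennreal ((\<Psi> s)\<^sup>2)" for i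
      by (intro ennreal_leI) (auto simp: v_def indicator_def)
    ultimately show "ennreal ((\<Psi> s)\<^sup>2) = (SUP i. ennreal ((v i s)\<^sup>2))"
      by (intro antisym SUP_least) (auto intro: SUP_upper)
  qed
  also have "\<dots> = (SUP i. \<integral>\<^sup>+s. ennreal ((v i s)\<^sup>2) \<partial>M)"
  proof (rule nn_integral_monotone_convergence_SUP)
    have "D i \<subseteq> D j" if "i \<le> j" for i j
      using that B(4) by (auto simp: D_def incseq_def)
    then show "incseq (\<lambda>i s. ennreal ((v i s)\<^sup>2))"
      by (auto simp: incseq_def le_fun_def v_def indicator_def intro!: ennreal_leI)
    show "(\<lambda>s. ennreal ((v i s)\<^sup>2)) \<in> borel_measurable M" for i
      unfolding v_def by measurable
  qed
  also have "\<dots> \<le> ennreal (K\<^sup>2)"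
  proof (rule SUP_least)
    fix i
    have "(\<integral>\<^sup>+s. ennreal ((v i s)\<^sup>2) \<partial>M) = ennreal ((norm2 M (v i))\<^sup>2)"
      unfolding norm2_squared by (intro nn_integral_eq_integral L2_square_integrable vL2) simp
    also have "\<dots> \<le> ennreal (K\<^sup>2)"
      using v_norm[of i] by (intro ennreal_leI power_mono) simp_all
    finally show "(\<integral>\<^sup>+s. ennreal ((v i s)\<^sup>2) \<partial>M) \<le> ennreal (K\<^sup>2)" .
  qed
  finally have bound: "(\<integral>\<^sup>+s. ennreal ((\<Psi> s)\<^sup>2) \<partial>M) \<le> ennreal (K\<^sup>2)" .
  then have int\<Psi>: "integrable M (\<lambda>s. (\<Psi> s)\<^sup>2)"
    by (intro integrableI_bounded) (auto simp: le_less_trans[OF _ ennreal_less_top])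
  then show "(\<lambda>s. \<integral>w. k w s \<partial>Q) \<in> L2 M"
    by (simp add: L2_def \<Psi>_def[symmetric])
  have "(\<integral>\<^sup>+s. ennreal ((\<Psi> s)\<^sup>2) \<partial>M) = ennreal ((norm2 M \<Psi>)\<^sup>2)"
    unfolding norm2_squared by (intro nn_integral_eq_integral int\<Psi>) simp
  then have "(norm2 M \<Psi>)\<^sup>2 \<le> K\<^sup>2"
    using bound by (simp add: ennreal_le_iff)
  then show "norm2 M (\<lambda>s. \<integral>w. k w s \<partial>Q) \<le> (\<integral>w. norm2 M (k w) \<partial>Q)"
    using power2_le_imp_le[OF _ K] by (simp add: \<Psi>_def[abs_def] K_def)
qed

lemma L2_set_integral_Minkowski:
  fixes k :: "real \<Rightarrow> real \<Rightarrow> real"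
  assumes A [measurable]: "A \<in> sets borel"
    and meas: "case_prod k \<in> borel_measurable (borel \<Otimes>\<^sub>M borel)"
    and L2: "\<And>w. w \<in> A \<Longrightarrow> k w \<in> L2 lborel"
    and int: "set_integrable lborel A (\<lambda>w. norm2 lborel (k w))"
  shows "(\<lambda>s. LINT w:A|lborel. k w s) \<in> L2 lborel"
    and "norm2 lborel (\<lambda>s. LINT w:A|lborel. k w s) \<le> (LINT w:A|lborel. norm2 lborel (k w))"
    and "v \<in> L2 lborel \<Longrightarrow> set_integrable lborel A (\<lambda>w. \<integral>s. v s * k w s \<partial>lborel)"
    and "v \<in> L2 lborel \<Longrightarrow> (\<integral>s. v s * (LINT w:A|lborel. k w s) \<partial>lborel) =
      (LINT w:A|lborel. (\<integral>s. v s * k w s \<partial>lborel))"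
proof -
  have [measurable]: "case_prod k \<in> borel_measurable (lborel \<Otimes>\<^sub>M lborel)"
    using meas by (simp add: measurable_lborel1 lborel_prod borel_prod)
  define k' where "k' w s = indicator A w * k w s" for w s
  have "case_prod k' \<in> borel_measurable (lborel \<Otimes>\<^sub>M lborel)"
    unfolding k'_def by measurable
  moreover have "k' w \<in> L2 lborel" for w
  proof (cases "w \<in> A")
    case True then show ?thesis using L2[OF True] by (simp add: k'_def[abs_def])
  next
    case False then show ?thesis by (simp add: k'_def[abs_def] L2_def)
  qed
  moreover have norm_k': "norm2 lborel (k' w) = indicator A w * norm2 lborel (k w)" for w
    by (simp add: k'_def[abs_def] norm2_scale)
  then have "integrable lborel (\<lambda>w. norm2 lborel (k' w))"
    using int by (simp add: set_integrable_def)
  ultimately have Minkowski: "sigma_finite_measure (lborel :: real measure)"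
      "sigma_finite_measure (lborel :: real measure)"
      "case_prod k' \<in> borel_measurable (lborel \<Otimes>\<^sub>M lborel)" "\<And>w. w \<in> space lborel \<Longrightarrow> k' w \<in> L2 lborel"
      "integrable lborel (\<lambda>w. norm2 lborel (k' w))"
    by (simp_all add: lborel.sigma_finite_measure_axioms)
  have inner: "(\<integral>s. v s * k' w s \<partial>lborel) = indicator A w * (\<integral>s. v s * k w s \<partial>lborel)" for v w
  proof -
    have "(\<lambda>s. v s * k' w s) = (\<lambda>s. indicator A w * (v s * k w s))"
      by (simp add: k'_def mult_ac)
    then show ?thesis by simp
  qed
  have \<Psi>: "(\<integral>w. k' w s \<partial>lborel) = (LINT w:A|lborel. k w s)" for s
    by (simp add: k'_def set_lebesgue_integral_def)
  show "(\<lambda>s. LINT w:A|lborel. k w s) \<in> L2 lborel"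
    using L2_Minkowski(1)[OF Minkowski] by (simp add: \<Psi>)
  show "norm2 lborel (\<lambda>s. LINT w:A|lborel. k w s) \<le> (LINT w:A|lborel. norm2 lborel (k w))"
    using L2_Minkowski(2)[OF Minkowski] by (simp add: \<Psi> norm_k' set_lebesgue_integral_def)
  assume v: "v \<in> L2 lborel"
  show "set_integrable lborel A (\<lambda>w. \<integral>s. v s * k w s \<partial>lborel)"
    using L2_Minkowski_pairing(1)[OF Minkowski v] by (simp add: inner set_integrable_def)
  show "(\<integral>s. v s * (LINT w:A|lborel. k w s) \<partial>lborel) = (LINT w:A|lborel. (\<integral>s. v s * k w s \<partial>lborel))"
    using L2_Minkowski_pairing(3)[OF Minkowski v] by (simp add: \<Psi> inner set_lebesgue_integral_def)
qed

section \<open>White noise and mean-square integrals\<close>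

lemma white_noise_L2:
  "gaussian_white_noise M \<sigma> E \<Longrightarrow> \<phi> \<in> L2 lborel \<Longrightarrow> E \<phi> \<in> L2 M"
  by (simp add: gaussian_white_noise_def)

lemma white_noise_mean:
  "gaussian_white_noise M \<sigma> E \<Longrightarrow> \<phi> \<in> L2 lborel \<Longrightarrow> (\<integral>\<omega>. E \<phi> \<omega> \<partial>M) = 0"
  by (simp add: gaussian_white_noise_def)

lemma white_noise_covariance:
  "gaussian_white_noise M \<sigma> E \<Longrightarrow> \<phi> \<in> L2 lborel \<Longrightarrow> \<psi> \<in> L2 lborel \<Longrightarrow>
    (\<integral>\<omega>. E \<phi> \<omega> * E \<psi> \<omega> \<partial>M) = \<sigma>\<^sup>2 * (\<integral>s. \<phi> s * \<psi> s \<partial>lborel)"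
  by (simp add: gaussian_white_noise_def)

lemma white_noise_norm:
  assumes "gaussian_white_noise M \<sigma> E" "\<phi> \<in> L2 lborel"
  shows "norm2 M (E \<phi>) = \<bar>\<sigma>\<bar> * norm2 lborel \<phi>"
  using white_noise_covariance[OF assms assms(2)]
  by (simp add: norm2_def power2_eq_square[symmetric] real_sqrt_mult)

lemma L2_square_zero_AE:
  assumes "Z \<in> L2 M" "(\<integral>x. (Z x)\<^sup>2 \<partial>M) = 0"
  shows "AE x in M. Z x = 0"
  using integral_nonneg_eq_0_iff_AE[OF L2_square_integrable[OF assms(1)]] assms(2) by simp

text \<open>
  The difference of the two sides has second moment \<open>\<sigma>\<^sup>2 \<parallel>\<rho> - a \<phi> - b \<psi>\<parallel>\<^sup>2 = 0\<close>, because the covariance is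
  bilinear in the test functions.
\<close>

lemma white_noise_linear:
  assumes noise: "gaussian_white_noise M \<sigma> E"
    and L2: "\<phi> \<in> L2 lborel" "\<psi> \<in> L2 lborel" "\<rho> \<in> L2 lborel"
    and eq: "AE s in lborel. \<rho> s = a * \<phi> s + b * \<psi> s"
  shows "AE \<omega> in M. E \<rho> \<omega> = a * E \<phi> \<omega> + b * E \<psi> \<omega>"
proof -
  note E = white_noise_L2[OF noise]
  note cov = white_noise_covariance[OF noise]
  define Z where "Z \<omega> = a * E \<phi> \<omega> + b * E \<psi> \<omega>" for \<omega>
  have Z: "Z \<in> L2 M"
    using L2_linear_combination[OF E[OF L2(1)] E[OF L2(2)]] by (simp add: Z_def[abs_def])
  define \<zeta> where "\<zeta> s = a * \<phi> s + b * \<psi> s" for s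
  have \<zeta>: "\<zeta> \<in> L2 lborel"
    using L2_linear_combination[OF L2(1,2)] by (simp add: \<zeta>_def[abs_def])
  have ZE: "(\<integral>\<omega>. E \<eta> \<omega> * Z \<omega> \<partial>M) = \<sigma>\<^sup>2 * (\<integral>s. \<eta> s * \<zeta> s \<partial>lborel)" if \<eta>: "\<eta> \<in> L2 lborel" for \<eta>
  proof -
    have "(\<integral>\<omega>. E \<eta> \<omega> * Z \<omega> \<partial>M) = (\<integral>\<omega>. a * (E \<eta> \<omega> * E \<phi> \<omega>) + b * (E \<eta> \<omega> * E \<psi> \<omega>) \<partial>M)"
      by (simp add: Z_def algebra_simps)
    also have "\<dots> = a * (\<sigma>\<^sup>2 * (\<integral>s. \<eta> s * \<phi> s \<partial>lborel)) + b * (\<sigma>\<^sup>2 * (\<integral>s. \<eta> s * \<psi> s \<partial>lborel))"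
      using L2 \<eta> by (simp add: L2_integrable_mult E cov)
    also have "\<dots> = \<sigma>\<^sup>2 * (\<integral>s. a * (\<eta> s * \<phi> s) + b * (\<eta> s * \<psi> s) \<partial>lborel)"
      using L2 \<eta> by (simp add: L2_integrable_mult algebra_simps)
    finally show ?thesis
      by (simp add: \<zeta>_def algebra_simps)
  qed
  have "(\<integral>\<omega>. Z \<omega> * Z \<omega> \<partial>M) = (\<integral>\<omega>. a * (E \<phi> \<omega> * Z \<omega>) + b * (E \<psi> \<omega> * Z \<omega>) \<partial>M)"
    by (intro Bochner_Integration.integral_cong) (simp_all add: Z_def algebra_simps)
  also have "\<dots> = a * (\<sigma>\<^sup>2 * (\<integral>s. \<phi> s * \<zeta> s \<partial>lborel)) + b * (\<sigma>\<^sup>2 * (\<integral>s. \<psi> s * \<zeta> s \<partial>lborel))"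
    using L2 Z by (simp add: L2_integrable_mult E ZE)
  also have "\<dots> = \<sigma>\<^sup>2 * (\<integral>s. a * (\<phi> s * \<zeta> s) + b * (\<psi> s * \<zeta> s) \<partial>lborel)"
    using L2 \<zeta> by (simp add: L2_integrable_mult algebra_simps)
  also have "(\<lambda>s. a * (\<phi> s * \<zeta> s) + b * (\<psi> s * \<zeta> s)) = (\<lambda>s. (\<zeta> s)\<^sup>2)"
    by (intro ext) (simp add: \<zeta>_def power2_eq_square algebra_simps)
  finally have ZZ: "(\<integral>\<omega>. (Z \<omega>)\<^sup>2 \<partial>M) = \<sigma>\<^sup>2 * (\<integral>s. (\<zeta> s)\<^sup>2 \<partial>lborel)"
    by (simp add: power2_eq_square)
  have [measurable]: "\<rho> \<in> borel_measurable lborel" "\<zeta> \<in> borel_measurable lborel"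
    using L2(3) \<zeta> by measurable
  have AE_eq: "AE s in lborel. \<rho> s = \<zeta> s"
    using eq by (simp add: \<zeta>_def)
  have "(\<integral>s. \<rho> s * \<zeta> s \<partial>lborel) = (\<integral>s. (\<zeta> s)\<^sup>2 \<partial>lborel)"
    "(\<integral>s. (\<rho> s)\<^sup>2 \<partial>lborel) = (\<integral>s. (\<zeta> s)\<^sup>2 \<partial>lborel)"
    using AE_eq by (auto intro!: integral_cong_AE simp: power2_eq_square)
  then have "(\<integral>\<omega>. (1 * E \<rho> \<omega> + (- 1) * Z \<omega>)\<^sup>2 \<partial>M) = 0"
    using cov[OF L2(3) L2(3)]
    by (subst integral_square_linear_combination[OF E[OF L2(3)] Z])
       (simp add: ZE[OF L2(3)] ZZ power2_eq_square[symmetric])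
  then have "AE \<omega> in M. 1 * E \<rho> \<omega> + (- 1) * Z \<omega> = 0"
    by (intro L2_square_zero_AE L2_linear_combination E[OF L2(3)] Z)
  then show ?thesis
    by (auto simp: Z_def)
qed

lemma white_noise_scale:
  assumes "gaussian_white_noise M \<sigma> E" "\<phi> \<in> L2 lborel"
  shows "AE \<omega> in M. E (\<lambda>s. a * \<phi> s) \<omega> = a * E \<phi> \<omega>"
  using white_noise_linear[OF assms(1,2,2) L2_scale[OF assms(2)], of a a 0] by simp

lemma expectation_cong_AE:
  assumes "Z \<in> L2 M" "Z' \<in> L2 M" "V \<in> L2 M" "V' \<in> L2 M"
    and "AE \<omega> in M. Z \<omega> = Z' \<omega>" "AE \<omega> in M. V \<omega> = V' \<omega>"
  shows "(\<integral>\<omega>. Z \<omega> \<partial>M) = (\<integral>\<omega>. Z' \<omega> \<partial>M)" and "(\<integral>\<omega>. Z \<omega> * V \<omega> \<partial>M) = (\<integral>\<omega>. Z' \<omega> * V' \<omega> \<partial>M)"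
proof -
  have [measurable]: "Z \<in> borel_measurable M" "Z' \<in> borel_measurable M" "V \<in> borel_measurable M" "V'
      \<in> borel_measurable M"
    using assms(1-4) by (simp_all add: L2_measurable)
  show "(\<integral>\<omega>. Z \<omega> \<partial>M) = (\<integral>\<omega>. Z' \<omega> \<partial>M)"
    using assms(5) by (intro integral_cong_AE) auto
  show "(\<integral>\<omega>. Z \<omega> * V \<omega> \<partial>M) = (\<integral>\<omega>. Z' \<omega> * V' \<omega> \<partial>M)"
    using assms(5,6) by (intro integral_cong_AE) auto
qed

text \<open>
  Two mean-square integrals have the same inner product with every \<open>V\<close>, in particular with their
  difference.
\<close>

lemma has_ms_integral_unique:
  assumes "has_ms_integral M A Y Z" "has_ms_integral M A Y Z'"
  shows "AE \<omega> in M. Z \<omega> = Z' \<omega>"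
proof -
  have Z: "Z \<in> L2 M" "Z' \<in> L2 M"
    using assms by (simp_all add: has_ms_integral_def)
  define D where "D \<omega> = 1 * Z \<omega> + (- 1) * Z' \<omega>" for \<omega>
  have D: "D \<in> L2 M"
    unfolding D_def by (rule L2_linear_combination[OF Z])
  have "(\<integral>\<omega>. Z \<omega> * D \<omega> \<partial>M) = (\<integral>\<omega>. Z' \<omega> * D \<omega> \<partial>M)"
    using assms D by (simp add: has_ms_integral_def)
  then have "(\<integral>\<omega>. Z \<omega> * D \<omega> - Z' \<omega> * D \<omega> \<partial>M) = 0"
    using Z D by (simp add: L2_integrable_mult)
  then have "(\<integral>\<omega>. (D \<omega>)\<^sup>2 \<partial>M) = 0"
    by (simp add: D_def power2_eq_square algebra_simps)
  from L2_square_zero_AE[OF D this] show ?thesis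
    by (auto simp: D_def)
qed

text \<open>
  Processes are determined only up to null sets; this lemma carries an integral formula from one
  version of a process to another.
\<close>

lemma has_ms_integral_cong_AE:
  assumes int: "has_ms_integral M A Y Z"
    and Y': "\<And>w. w \<in> A \<Longrightarrow> Y' w \<in> L2 M" "\<And>w. w \<in> A \<Longrightarrow> AE \<omega> in M. Y' w \<omega> = Y w \<omega>"
    and Z': "Z' \<in> L2 M" "AE \<omega> in M. Z' \<omega> = Z \<omega>"
  shows "has_ms_integral M A Y' Z'"
  unfolding has_ms_integral_def
proof (intro conjI ballI)
  fix V assume V: "V \<in> L2 M"
  have [measurable]: "V \<in> borel_measurable M" "Z \<in> borel_measurable M" "Z' \<in> borel_measurable M"
    using V Z' int by (simp_all add: has_ms_integral_def L2_measurable)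
  have eq: "(\<integral>\<omega>. Y' w \<omega> * V \<omega> \<partial>M) = (\<integral>\<omega>. Y w \<omega> * V \<omega> \<partial>M)" if "w \<in> A" for w
  proof (rule integral_cong_AE)
    have [measurable]: "Y w \<in> borel_measurable M" "Y' w \<in> borel_measurable M"
      using Y'(1)[OF that] int that by (simp_all add: has_ms_integral_def L2_measurable)
    show "(\<lambda>\<omega>. Y' w \<omega> * V \<omega>) \<in> borel_measurable M" "(\<lambda>\<omega>. Y w \<omega> * V \<omega>) \<in> borel_measurable M"
      by measurable
    show "AE \<omega> in M. Y' w \<omega> * V \<omega> = Y w \<omega> * V \<omega>"
      using Y'(2)[OF that] by auto
  qed
  have ind: "(\<lambda>w. indicator A w *\<^sub>R (\<integral>\<omega>. Y' w \<omega> * V \<omega> \<partial>M)) = (\<lambda>w. indicator A w *\<^sub>R (\<integral>\<omega>. Y w \<omega> * V \<omega> \<partial>M))"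
    using eq by (auto simp: indicator_def)
  have "(\<integral>\<omega>. Z' \<omega> * V \<omega> \<partial>M) = (\<integral>\<omega>. Z \<omega> * V \<omega> \<partial>M)"
    using Z'(2) by (intro integral_cong_AE) auto
  then show "set_integrable lborel A (\<lambda>w. \<integral>\<omega>. Y' w \<omega> * V \<omega> \<partial>M)"
    "(\<integral>\<omega>. Z' \<omega> * V \<omega> \<partial>M) = (LINT w:A|lborel. (\<integral>\<omega>. Y' w \<omega> * V \<omega> \<partial>M))"
    using int V unfolding set_integrable_def set_lebesgue_integral_def ind
    by (auto simp: has_ms_integral_def set_integrable_def set_lebesgue_integral_def)
qed (use Y'(1) Z'(1) in auto)

text \<open>
  For fixed \<open>V\<close> the functional \<open>l \<phi> = \<integral> E \<phi> \<cdot> V\<close> is linear and bounded by \<open>\<bar>\<sigma>\<bar> \<parallel>V\<parallel>\<close>.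
  It is the limit of inner products with functions \<open>v n\<close>, which can be interchanged with the integral over \<open>w\<close>; this also makes
  \<open>w \<mapsto> l (k w)\<close> measurable. Dominated convergence with the bound \<open>(1 + C) \<parallel>k w\<parallel>\<close> gives the claim for \<open>l\<close>.
\<close>

lemma white_noise_ms_integral:
  assumes noise: "gaussian_white_noise M \<sigma> E"
    and A [measurable]: "A \<in> sets borel"
    and meas: "case_prod k \<in> borel_measurable (borel \<Otimes>\<^sub>M borel)"
    and L2: "\<And>w. w \<in> A \<Longrightarrow> k w \<in> L2 lborel"
    and int: "set_integrable lborel A (\<lambda>w. norm2 lborel (k w))"
  shows "has_ms_integral M A (\<lambda>w. E (k w)) (E (\<lambda>s. LINT w:A|lborel. k w s))"
proof -
  note E = white_noise_L2[OF noise]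
  define \<Psi> where "\<Psi> s = (LINT w:A|lborel. k w s)" for s
  note Minkowski = L2_set_integral_Minkowski[OF A meas L2 int, folded \<Psi>_def]
  have \<Psi>: "\<Psi> \<in> L2 lborel"
    using Minkowski(1) by (simp add: \<Psi>_def[abs_def])
  have "has_ms_integral M A (\<lambda>w. E (k w)) (E \<Psi>)"
    unfolding has_ms_integral_def
  proof (intro conjI ballI)
    fix V assume V: "V \<in> L2 M"
    define l where "l \<phi> = (\<integral>\<omega>. E \<phi> \<omega> * V \<omega> \<partial>M)" for \<phi>
    define C where "C = \<bar>\<sigma>\<bar> * norm2 M V"
    have [measurable]: "V \<in> borel_measurable M" using V by measurable
    have l_linear: "l (\<lambda>s. f s + t * g s) = l f + t * l g"
      if "f \<in> L2 lborel" "g \<in> L2 lborel" for f g t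
    proof -
      have fg: "(\<lambda>s. f s + t * g s) \<in> L2 lborel"
        using L2_linear_combination[OF that, of 1 t] by simp
      have [measurable]: "E f \<in> borel_measurable M" "E g \<in> borel_measurable M"
          "E (\<lambda>s. f s + t * g s) \<in> borel_measurable M"
        using E[OF fg] that[THEN E] by (simp_all add: L2_measurable)
      have "AE \<omega> in M. E (\<lambda>s. f s + t * g s) \<omega> = 1 * E f \<omega> + t * E g \<omega>"
        by (rule white_noise_linear[OF noise that fg]) simp
      then have "l (\<lambda>s. f s + t * g s) = (\<integral>\<omega>. E f \<omega> * V \<omega> + t * (E g \<omega> * V \<omega>) \<partial>M)"
        unfolding l_def by (intro integral_cong_AE) (auto simp: algebra_simps)
      also have "\<dots> = l f + t * l g"
        using that V by (simp add: l_def L2_integrable_mult E)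
      finally show ?thesis .
    qed
    have l_bound: "\<bar>l f\<bar> \<le> C * norm2 lborel f" if "f \<in> L2 lborel" for f
      using L2_Cauchy_Schwarz[OF E[OF that] V] white_noise_norm[OF noise that]
      by (simp add: l_def C_def mult_ac)
    have "\<forall>n. \<exists>v\<in>L2 lborel. \<forall>f\<in>L2 lborel.
        \<bar>(\<integral>s. v s * f s \<partial>lborel) - l f\<bar> \<le> inverse (real (Suc n)) * norm2 lborel f"
      by (intro allI approximate_Riesz_representation[OF l_linear l_bound]) simp_all
    then obtain v where v: "\<And>n. v n \<in> L2 lborel"
      "\<And>n f. f \<in> L2 lborel \<Longrightarrow>
        \<bar>(\<integral>s. v n s * f s \<partial>lborel) - l f\<bar> \<le> inverse (real (Suc n)) * norm2 lborel f"
      by metis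
    have lim: "(\<lambda>n. \<integral>s. v n s * f s \<partial>lborel) \<longlonglongrightarrow> l f" if "f \<in> L2 lborel" for f
    proof -
      have "(\<lambda>n. inverse (real (Suc n)) * norm2 lborel f) \<longlonglongrightarrow> 0"
        using tendsto_mult_right[OF LIMSEQ_inverse_real_of_nat, of "norm2 lborel f"] by simp
      then have "(\<lambda>n. (\<integral>s. v n s * f s \<partial>lborel) - l f) \<longlonglongrightarrow> 0"
        by (rule Lim_null_comparison[rotated]) (use v(2)[OF that] in simp)
      then show ?thesis by (simp add: LIM_zero_iff)
    qed
    have v_int: "integrable lborel (\<lambda>w. indicator A w * (\<integral>s. v n s * k w s \<partial>lborel))" for n
      using Minkowski(3)[OF _ v(1)[of n]] by (simp add: set_integrable_def)
    have v_eq: "(\<integral>s. v n s * \<Psi> s \<partial>lborel) = (\<integral>w. indicator A w * (\<integral>s. v n s * k w s \<partial>lborel) \<partial>lborel)" for n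
      using Minkowski(4)[OF _ v(1)[of n]] by (simp add: set_lebesgue_integral_def)
    have lim_k: "(\<lambda>n. indicator A w * (\<integral>s. v n s * k w s \<partial>lborel)) \<longlonglongrightarrow> indicator A w * l (k w)" for w
      using lim[OF L2] by (cases "w \<in> A") auto
    have l_meas [measurable]: "(\<lambda>w. indicator A w * l (k w)) \<in> borel_measurable lborel"
      by (rule borel_measurable_LIMSEQ_real[OF lim_k])
         (use v_int borel_measurable_integrable in blast)
    have norm_int: "integrable lborel (\<lambda>w. D * (indicator A w * norm2 lborel (k w)))" for D
      using int by (simp add: set_integrable_def)
    have "integrable lborel (\<lambda>w. indicator A w * l (k w))"
    proof (rule Bochner_Integration.integrable_bound[OF norm_int[of C]])
      show "AE w in lborel. norm (indicator A w * l (k w)) \<le> norm (C *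
          (indicator A w * norm2 lborel (k w)))"
        using l_bound[OF L2] by (auto simp: indicator_def intro: order_trans[OF _ abs_ge_self])
    qed measurable
    then show "set_integrable lborel A (\<lambda>w. \<integral>\<omega>. E (k w) \<omega> * V \<omega> \<partial>M)"
      by (simp add: set_integrable_def l_def)
    have "(\<lambda>n. (\<integral>w. indicator A w * (\<integral>s. v n s * k w s \<partial>lborel) \<partial>lborel))
        \<longlonglongrightarrow> (\<integral>w. indicator A w * l (k w) \<partial>lborel)"
    proof (rule integral_dominated_convergence[OF _ _ norm_int[of "1 + C"]])
      fix n
      show "AE w in lborel. norm (indicator A w * (\<integral>s. v n s * k w s \<partial>lborel))
          \<le> (1 + C) * (indicator A w * norm2 lborel (k w))"
      proof (rule AE_I2)
        fix w
        have "inverse (real (Suc n)) * norm2 lborel (k w) \<le> 1 * norm2 lborel (k w)"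
          by (intro mult_right_mono) (auto simp: field_simps)
        then show "norm (indicator A w * (\<integral>s. v n s * k w s \<partial>lborel))
            \<le> (1 + C) * (indicator A w * norm2 lborel (k w))"
          using v(2)[OF L2, of w n] l_bound[OF L2, of w] by (cases "w \<in> A") (auto simp: distrib_right)
      qed
    qed (use v_int lim_k in auto)
    then have "(\<integral>w. indicator A w * l (k w) \<partial>lborel) = l \<Psi>"
      using LIMSEQ_unique lim[OF \<Psi>] by (simp add: v_eq)
    then show "(\<integral>\<omega>. E \<Psi> \<omega> * V \<omega> \<partial>M) = (LINT w:A|lborel. (\<integral>\<omega>. E (k w) \<omega> * V \<omega> \<partial>M))"
      by (simp add: l_def set_lebesgue_integral_def)
  qed (use E L2 \<Psi> in auto)
  then show ?thesis
    by (simp add: \<Psi>_def[abs_def])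
qed

section \<open>The heat kernel\<close>

text \<open>
  With the variance \<open>2 w\<close> the facts on normal densities become facts on the heat kernel.
\<close>

lemma heat_kernel_eq_normal_density:
  "w > 0 \<Longrightarrow> heat_kernel x w = normal_density 0 (sqrt (2 * w)) x"
  by (simp add: heat_kernel_def normal_density_def)

lemma heat_kernel_nonneg: "w > 0 \<Longrightarrow> heat_kernel x w \<ge> 0"
  by (simp add: heat_kernel_def)

lemma heat_kernel_even: "heat_kernel (- x) w = heat_kernel x w"
  by (simp add: heat_kernel_def)

lemma borel_measurable_heat_kernel [measurable (raw)]:
  assumes [measurable]: "f \<in> borel_measurable M" "g \<in> borel_measurable M"
  shows "(\<lambda>x. heat_kernel (f x) (g x)) \<in> borel_measurable M"
  unfolding heat_kernel_def by measurable

lemma heat_kernel_le_at_zero: "w > 0 \<Longrightarrow> heat_kernel x w \<le> heat_kernel 0 w"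
  by (simp add: heat_kernel_def divide_right_mono)

lemma heat_kernel_integrable: "w > 0 \<Longrightarrow> integrable lborel (\<lambda>x. heat_kernel x w)"
  by (simp add: heat_kernel_eq_normal_density)

lemma heat_kernel_integral: "w > 0 \<Longrightarrow> (\<integral>x. heat_kernel x w \<partial>lborel) = 1"
  by (simp add: heat_kernel_eq_normal_density)

lemma heat_kernel_shift_integrable: "w > 0 \<Longrightarrow> integrable lborel (\<lambda>s. heat_kernel (t - s) w)"
  using lborel_integrable_real_affine[OF heat_kernel_integrable, of w "-1" t] by simp

lemma heat_kernel_shift_integral: "w > 0 \<Longrightarrow> (\<integral>s. heat_kernel (t - s) w \<partial>lborel) = 1"
  using lborel_integral_real_affine[of "-1" "\<lambda>x. heat_kernel x w" t] heat_kernel_integral[of w] by simp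

text \<open>
  The convolution of two centred normal densities is normal, and the variances \<open>2 w\<close> and \<open>2 w'\<close> add up.
\<close>

lemma heat_kernel_semigroup:
  assumes w: "w > 0" "w' > 0"
  shows "(\<integral>s. heat_kernel (s - t) w * heat_kernel (s - t') w' \<partial>lborel) = heat_kernel (t - t') (w + w')"
    and "integrable lborel (\<lambda>s. heat_kernel (s - t) w * heat_kernel (s - t') w')"
proof -
  have "(\<integral>\<^sup>+y. ennreal (heat_kernel ((t - t') - y) w * heat_kernel y w') \<partial>lborel) =
      ennreal (heat_kernel (t - t') (w + w'))"
    using fun_cong[OF conv_normal_density_zero_mean[of "sqrt (2 * w)" "sqrt (2 * w')"], of "t - t'"] w
    by (simp add: heat_kernel_eq_normal_density)
  also have "(\<integral>\<^sup>+y. ennreal (heat_kernel ((t - t') - y) w * heat_kernel y w') \<partial>lborel) =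
      (\<integral>\<^sup>+s. ennreal (heat_kernel ((t - t') - (- t' + 1 * s)) w * heat_kernel (- t' + 1 * s) w') \<partial>lborel)"
    by (subst nn_integral_real_affine[of _ 1 "- t'"]) simp_all
  also have "\<dots> = (\<integral>\<^sup>+s. ennreal (heat_kernel (s - t) w * heat_kernel (s - t') w') \<partial>lborel)"
    using heat_kernel_even[of "s - t" w for s] by (intro nn_integral_cong) (simp add: algebra_simps)
  finally have "has_bochner_integral lborel (\<lambda>s. heat_kernel (s - t) w * heat_kernel (s - t') w')
      (heat_kernel (t - t') (w + w'))"
    using w by (intro has_bochner_integral_nn_integral) (simp_all add: heat_kernel_nonneg)
  then show "(\<integral>s. heat_kernel (s - t) w * heat_kernel (s - t') w' \<partial>lborel) = heat_kernel (t - t') (w + w')"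
    "integrable lborel (\<lambda>s. heat_kernel (s - t) w * heat_kernel (s - t') w')"
    by (simp_all add: has_bochner_integral_iff)
qed

lemma heat_kernel_L2: "w > 0 \<Longrightarrow> (\<lambda>s. heat_kernel (s - t) w) \<in> L2 lborel"
  using heat_kernel_semigroup(2)[of w w t t] by (simp add: L2_def power2_eq_square)

lemma norm2_heat_kernel: "w > 0 \<Longrightarrow> norm2 lborel (\<lambda>s. heat_kernel (s - t) w) = sqrt (heat_kernel 0 (2 * w))"
  using heat_kernel_semigroup(1)[of w w t t] by (simp add: norm2_def power2_eq_square)

lemma heat_kernel_Fourier:
  assumes w: "w > 0"
  shows "(\<integral>h. exp (\<i> * complex_of_real (\<tau> * h)) * complex_of_real (heat_kernel h w) \<partial>lborel)
    = complex_of_real (exp (- (w * \<tau>\<^sup>2)))"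
proof -
  define c where "c = sqrt (2 * w)"
  have c: "c > 0" "c\<^sup>2 = 2 * w"
    using w by (simp_all add: c_def)
  have scale: "\<bar>c\<bar> * heat_kernel (0 + c * y) w = std_normal_density y" for y
  proof -
    have "sqrt (4 * pi * w) = c * sqrt (2 * pi)"
      by (simp add: c_def real_sqrt_mult)
    moreover have "(c * y)\<^sup>2 / (4 * w) = y\<^sup>2 / 2"
      using c w by (simp add: power_mult_distrib)
    ultimately show ?thesis
      using c by (simp add: heat_kernel_def std_normal_density_def)
  qed
  have "(\<integral>h. exp (\<i> * complex_of_real (\<tau> * h)) * complex_of_real (heat_kernel h w) \<partial>lborel) =
      \<bar>c\<bar> *\<^sub>R (\<integral>y. exp (\<i> * complex_of_real (\<tau> * (0 + c * y))) *
          complex_of_real (heat_kernel (0 + c * y) w) \<partial>lborel)"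
    using c by (subst lborel_integral_real_affine[of c _ 0]) simp_all
  also have "\<dots> = (\<integral>y. \<bar>c\<bar> *\<^sub>R (exp (\<i> * complex_of_real (\<tau> * (0 + c * y))) *
      complex_of_real (heat_kernel (0 + c * y) w)) \<partial>lborel)"
    by simp
  also have "\<dots> = (\<integral>y. std_normal_density y *\<^sub>R exp (\<i> * complex_of_real (\<tau> * c * y)) \<partial>lborel)"
    unfolding scale[symmetric] by (simp add: scaleR_conv_of_real mult_ac)
  also have "\<dots> = char std_normal_distribution (\<tau> * c)"
    unfolding char_def
    by (subst integral_density) (auto simp: normal_density_nonneg mult_ac)
  also have "\<dots> = complex_of_real (exp (- (w * \<tau>\<^sup>2)))"
    using c by (simp add: char_std_normal_distribution power_mult_distrib mult_ac)
  finally show ?thesis .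
qed

section \<open>Gamma weights\<close>

text \<open>
  The density of the gamma distribution with parameters \<open>\<mu>\<close> and \<open>a\<close> on the positive half-line, up to the
  factor \<open>\<mu>\<^sup>a\<close>. With \<open>\<mu> - d\<^sup>2/dt\<^sup>2\<close> in place of \<open>\<mu>\<close> its integral is the formula for \<open>(\<mu> - d\<^sup>2/dt\<^sup>2)\<^sup>-\<^sup>a\<close>.
\<close>

definition gamma_weight :: "real \<Rightarrow> real \<Rightarrow> real \<Rightarrow> real" where
  "gamma_weight \<mu> a w = 1 / Gamma a * (w powr (a - 1) * exp (- \<mu> * w))"

lemma borel_measurable_gamma_weight [measurable (raw)]:
  assumes [measurable]: "f \<in> borel_measurable M"
  shows "(\<lambda>x. gamma_weight \<mu> a (f x)) \<in> borel_measurable M"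
  unfolding gamma_weight_def by measurable

lemma gamma_weight_nonneg: "a > 0 \<Longrightarrow> gamma_weight \<mu> a w \<ge> 0"
  by (simp add: gamma_weight_def)

lemma Gamma_integral_exp_scaled:
  fixes a \<mu> :: real
  assumes "a > 0" "\<mu> > 0"
  shows "set_integrable lborel {0<..} (\<lambda>w. w powr (a - 1) * exp (- \<mu> * w))"
    and "(LINT w:{0<..}|lborel. w powr (a - 1) * exp (- \<mu> * w)) = Gamma a / \<mu> powr a"
proof -
  have "ennreal (Gamma a) = (\<integral>\<^sup>+t. ennreal (indicator {0..} t * t powr (a - 1) / exp t) \<partial>lborel)"
    by (rule Gamma_conv_nn_integral_real) fact
  also have "\<dots> = ennreal \<bar>\<mu>\<bar> * (\<integral>\<^sup>+w. ennreal (indicator {0..} (0 + \<mu> * w) * (0 + \<mu> * w) powr (a - 1) /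
      exp (0 + \<mu> * w)) \<partial>lborel)"
    using assms by (intro nn_integral_real_affine) simp_all
  also have "\<dots> = (\<integral>\<^sup>+w. ennreal \<bar>\<mu>\<bar> * ennreal (indicator {0..} (0 + \<mu> * w) * (0 + \<mu> * w) powr (a - 1) /
      exp (0 + \<mu> * w)) \<partial>lborel)"
    by (intro nn_integral_cmult[symmetric]) measurable
  also have "\<dots> = (\<integral>\<^sup>+w. ennreal (\<mu> powr a) * ennreal (indicator {0<..} w
      *\<^sub>R (w powr (a - 1) * exp (- \<mu> * w))) \<partial>lborel)"
  proof (rule nn_integral_cong)
    fix w :: real
    consider "w < 0" | "w = 0" | "w > 0" by linarith
    then show "ennreal \<bar>\<mu>\<bar> * ennreal (indicator {0..} (0 + \<mu> * w) * (0 + \<mu> * w) powr (a - 1) /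
        exp (0 + \<mu> * w)) =
        ennreal (\<mu> powr a) * ennreal (indicator {0<..} w *\<^sub>R (w powr (a - 1) * exp (- \<mu> * w)))"
    proof cases
      case 3
      have "\<mu> * \<mu> powr (a - 1) = \<mu> powr a"
        using assms by (simp add: powr_diff)
      then have "\<mu> * ((\<mu> * w) powr (a - 1) / exp (\<mu> * w)) = \<mu> powr a * (w powr (a - 1) * exp (- \<mu> * w))"
        using assms 3 by (simp add: powr_mult exp_minus field_simps)
      then show ?thesis
        using assms 3 by (simp add: ennreal_mult[symmetric])
    qed (use assms in \<open>simp_all add: mult_less_0_iff not_le indicator_def\<close>)
  qed
  also have "\<dots> = ennreal (\<mu> powr a) * (\<integral>\<^sup>+w. ennreal (indicator {0<..} w
      *\<^sub>R (w powr (a - 1) * exp (- \<mu> * w))) \<partial>lborel)"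
    by (intro nn_integral_cmult) measurable
  finally have "ennreal (\<mu> powr (- a)) * ennreal (Gamma a) =
      ennreal (\<mu> powr (- a)) * ennreal (\<mu> powr a) * (\<integral>\<^sup>+w. ennreal (indicator {0<..} w
          *\<^sub>R (w powr (a - 1) * exp (- \<mu> * w))) \<partial>lborel)"
    by (simp add: mult.assoc)
  also have "ennreal (\<mu> powr (- a)) * ennreal (\<mu> powr a) = 1"
    using assms by (simp add: ennreal_mult[symmetric] powr_add[symmetric])
  finally have "(\<integral>\<^sup>+w. ennreal (indicator {0<..} w *\<^sub>R (w powr (a - 1) * exp (- \<mu> * w))) \<partial>lborel)
      = ennreal (Gamma a / \<mu> powr a)"
    using assms by (simp add: ennreal_mult[symmetric] powr_minus_divide)
  then have "has_bochner_integral lborel (\<lambda>w. indicator {0<..} w *\<^sub>R (w powr (a - 1) * exp (- \<mu> * w)))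
      (Gamma a / \<mu> powr a)"
    using assms by (intro has_bochner_integral_nn_integral) (simp_all)
  then show "set_integrable lborel {0<..} (\<lambda>w. w powr (a - 1) * exp (- \<mu> * w))"
    "(LINT w:{0<..}|lborel. w powr (a - 1) * exp (- \<mu> * w)) = Gamma a / \<mu> powr a"
    by (simp_all add: has_bochner_integral_iff set_integrable_def set_lebesgue_integral_def)
qed

lemma gamma_weight_integrable:
  "a > 0 \<Longrightarrow> \<mu> > 0 \<Longrightarrow> set_integrable lborel {0<..} (gamma_weight \<mu> a)"
  unfolding gamma_weight_def by (intro set_integrable_mult_right Gamma_integral_exp_scaled(1))

lemma gamma_weight_integral:
  assumes "a > 0" "\<mu> > 0"
  shows "(LINT w:{0<..}|lborel. gamma_weight \<mu> a w) = \<mu> powr (- a)"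
  using Gamma_integral_exp_scaled(2)[OF assms] Gamma_real_pos[OF assms(1)]
  by (simp add: gamma_weight_def powr_minus_divide)

lemma gamma_weight_powr_integrable:
  assumes "a > 0" "a + r > 0" "\<mu> > 0"
  shows "set_integrable lborel {0<..} (\<lambda>w. gamma_weight \<mu> a w * w powr r)"
proof -
  have "set_integrable lborel {0<..} (\<lambda>w. 1 / Gamma a * (w powr (a + r - 1) * exp (- \<mu> * w)))"
    using assms by (intro set_integrable_mult_right Gamma_integral_exp_scaled(1))
  moreover have "1 / Gamma a * (w powr (a + r - 1) * exp (- \<mu> * w)) = gamma_weight \<mu> a w * w powr r" for w
  proof -
    have "a + r - 1 = (a - 1) + r" by simp
    then have "w powr (a + r - 1) = w powr (a - 1) * w powr r"
      by (simp only: powr_add)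
    then show ?thesis
      by (simp add: gamma_weight_def)
  qed
  ultimately show ?thesis by simp
qed

text \<open>
  Near \<open>w = 0\<close> the heat kernel behaves like \<open>w\<^sup>-\<^sup>1\<^sup>/\<^sup>2\<close> at \<open>h = 0\<close>, which \<open>w\<^sup>a\<^sup>-\<^sup>1\<close> compensates for \<open>a > 1/2\<close>. At
  \<open>h \<noteq> 0\<close> it is bounded in \<open>w\<close>, because \<open>y \<le> exp (y\<^sup>2)\<close> for \<open>y = \<bar>h\<bar> / (2 \<surd>w)\<close>.
\<close>

lemma gamma_weight_heat_kernel_integrable:
  assumes "a > 0" "\<mu> > 0" and h: "h \<noteq> 0 \<or> a > 1 / 2"
  shows "set_integrable lborel {0<..} (\<lambda>w. gamma_weight \<mu> a w * heat_kernel h w)"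
proof (cases "h = 0")
  case True
  then have "a > 1 / 2" using h by simp
  have "set_integrable lborel {0<..} (\<lambda>w. (1 / sqrt (4 * pi)) * (gamma_weight \<mu> a w * w powr (- (1/2))))"
    using assms \<open>a > 1 / 2\<close> by (intro set_integrable_mult_right gamma_weight_powr_integrable) auto
  moreover have "(1 / sqrt (4 * pi)) * (gamma_weight \<mu> a w * w powr (- (1/2)))
      = gamma_weight \<mu> a w * heat_kernel h w"
    if "w \<in> {0<..}" for w
    using that True by (simp add: heat_kernel_def powr_minus_divide powr_half_sqrt real_sqrt_mult)
  ultimately show ?thesis
    using set_integrable_cong[OF refl refl] by (metis (no_types, lifting))
next
  case False
  have bound: "heat_kernel h w \<le> 1 / (\<bar>h\<bar> * sqrt pi)" if w: "w > 0" for w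
  proof -
    define y where "y = \<bar>h\<bar> / (2 * sqrt w)"
    have y: "y > 0" "y\<^sup>2 = h\<^sup>2 / (4 * w)"
      using w False by (simp_all add: y_def power_divide power_mult_distrib)
    have "y \<le> 1 + y\<^sup>2"
      using sum_squares_bound[of y 1] y(1) by simp
    also have "\<dots> \<le> exp (y\<^sup>2)"
      by (rule exp_ge_add_one_self)
    finally have "exp (- (y\<^sup>2)) \<le> 1 / y"
      using y(1) by (simp add: exp_minus field_simps)
    then have "exp (- (y\<^sup>2)) / sqrt (4 * pi * w) \<le> (1 / y) / sqrt (4 * pi * w)"
      by (rule divide_right_mono) (use w in simp)
    then have "heat_kernel h w \<le> (1 / y) / sqrt (4 * pi * w)"
      by (simp add: heat_kernel_def y(2))
    also have "\<dots> = 1 / (\<bar>h\<bar> * sqrt pi)"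
      using w by (simp add: y_def real_sqrt_mult)
    finally show ?thesis .
  qed
  have dom: "set_integrable lborel {0<..} (\<lambda>w. (1 / (\<bar>h\<bar> * sqrt pi)) * gamma_weight \<mu> a w)"
    using assms by (intro set_integrable_mult_right gamma_weight_integrable)
  show ?thesis
  proof (rule set_integrable_bound[OF dom])
    show "set_borel_measurable lborel {0<..} (\<lambda>w. gamma_weight \<mu> a w * heat_kernel h w)"
      unfolding set_borel_measurable_def by measurable
    show "AE w in lborel. w \<in> {0<..} \<longrightarrow> norm (gamma_weight \<mu> a w * heat_kernel h w)
        \<le> norm ((1 / (\<bar>h\<bar> * sqrt pi)) * gamma_weight \<mu> a w)"
    proof (intro AE_I2 impI)
      fix w :: real assume w: "w \<in> {0<..}"
      have "gamma_weight \<mu> a w * heat_kernel h w \<le> gamma_weight \<mu> a w * (1 / (\<bar>h\<bar> * sqrt pi))"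
        using bound[of w] w assms by (intro mult_left_mono) (simp_all add: gamma_weight_nonneg)
      then show "norm (gamma_weight \<mu> a w * heat_kernel h w)
          \<le> norm ((1 / (\<bar>h\<bar> * sqrt pi)) * gamma_weight \<mu> a w)"
        using w assms by (simp add: gamma_weight_nonneg heat_kernel_nonneg abs_mult)
    qed
  qed
qed

text \<open>
  The square root is the \<open>L\<^sup>2\<close> norm of the heat kernel at time \<open>w\<close> and equals \<open>(8 \<pi> w)\<^sup>-\<^sup>1\<^sup>/\<^sup>4\<close>. This is the
  place where the condition \<open>\<beta> > 1/4\<close> arises.
\<close>

lemma gamma_weight_sqrt_heat_kernel_integrable:
  assumes "a > 1 / 4" "\<mu> > 0"
  shows "set_integrable lborel {0<..} (\<lambda>w. gamma_weight \<mu> a w * sqrt (heat_kernel 0 (2 * w)))"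
proof -
  have "set_integrable lborel {0<..} (\<lambda>w. (1 / sqrt (sqrt (8 * pi))) *
      (gamma_weight \<mu> a w * w powr (- (1/4))))"
    using assms by (intro set_integrable_mult_right gamma_weight_powr_integrable) auto
  moreover have "(1 / sqrt (sqrt (8 * pi))) * (gamma_weight \<mu> a w * w powr (- (1/4))) =
      gamma_weight \<mu> a w * sqrt (heat_kernel 0 (2 * w))" if "w \<in> {0<..}" for w
  proof -
    have "w powr (1/4) = sqrt (sqrt w)"
      using that by (simp add: powr_half_sqrt[symmetric] powr_powr)
    then show ?thesis
      using that by (simp add: heat_kernel_def powr_minus_divide real_sqrt_mult real_sqrt_divide)
  qed
  ultimately show ?thesis
    using set_integrable_cong[OF refl refl] by (metis (no_types, lifting))
qed

text \<open>
  The substitution \<open>y = x t\<close> turns the convolution into the Beta integral.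
\<close>

lemma gamma_weight_convolution_pointwise:
  assumes "a > 0" "b > 0"
  shows "(\<integral>\<^sup>+y. ennreal (indicator {0<..} (x - y) * gamma_weight \<mu> a (x - y)) *
      ennreal (indicator {0<..} y * gamma_weight \<mu> b y) \<partial>lborel)
    = ennreal (indicator {0<..} x * gamma_weight \<mu> (a + b) x)"
proof (cases "x > 0")
  case False
  then have zero: "ennreal (indicator {0<..} (x - y) * gamma_weight \<mu> a (x - y)) *
      ennreal (indicator {0<..} y * gamma_weight \<mu> b y) = 0" for y
    by (auto simp: indicator_def)
  show ?thesis using False unfolding zero by simp
next
  case x: True
  have Gamma_pos: "Gamma a > 0" "Gamma b > 0" "Gamma (a + b) > 0"
    using assms by simp_all
  define c where "c = x powr (a + b - 1) * exp (- \<mu> * x) / (Gamma a * Gamma b)"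
  have c: "c \<ge> 0" using Gamma_pos by (simp add: c_def)
  have "(\<integral>\<^sup>+y. ennreal (indicator {0<..} (x - y) * gamma_weight \<mu> a (x - y)) *
      ennreal (indicator {0<..} y * gamma_weight \<mu> b y) \<partial>lborel)
    = ennreal \<bar>x\<bar> * (\<integral>\<^sup>+t. ennreal (indicator {0<..} (x - (0 + x * t)) * gamma_weight
        \<mu> a (x - (0 + x * t))) * ennreal (indicator {0<..} (0 + x * t) * gamma_weight \<mu> b (0 + x * t))
        \<partial>lborel)"
    using x by (intro nn_integral_real_affine) simp_all
  also have "\<dots> = (\<integral>\<^sup>+t. ennreal \<bar>x\<bar> * (ennreal (indicator {0<..} (x - (0 + x * t)) * gamma_weight
      \<mu> a (x - (0 + x * t))) * ennreal (indicator {0<..} (0 + x * t) * gamma_weight \<mu> b (0 + x * t)))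
      \<partial>lborel)"
    by (intro nn_integral_cmult[symmetric]) measurable
  also have "\<dots> = (\<integral>\<^sup>+t. ennreal c * ennreal (indicator {0..1} t *
      (t powr (b - 1) * (1 - t) powr (a - 1))) \<partial>lborel)"
  proof (rule nn_integral_cong)
    fix t :: real
    have pos: "x - x * t > 0 \<longleftrightarrow> t < 1" "x * t > 0 \<longleftrightarrow> t > 0"
      using x by (simp_all add: zero_less_mult_iff)
    show "ennreal \<bar>x\<bar> * (ennreal (indicator {0<..} (x - (0 + x * t)) * gamma_weight
        \<mu> a (x - (0 + x * t))) * ennreal (indicator {0<..} (0 + x * t) * gamma_weight \<mu> b (0 + x * t)))
      = ennreal c * ennreal (indicator {0..1} t * (t powr (b - 1) * (1 - t) powr (a - 1)))"
    proof (cases "0 < t \<and> t < 1")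
      case True
      have "x * (x powr (a - 1) * x powr (b - 1)) = x powr 1 * x powr (a - 1) * x powr (b - 1)"
        using x by simp
      also have "\<dots> = x powr (1 + (a - 1) + (b - 1))"
        by (simp only: powr_add)
      finally have xp: "x * (x powr (a - 1) * x powr (b - 1)) = x powr (a + b - 1)"
        by (simp add: algebra_simps)
      have "x - x * t = x * (1 - t)" by (simp add: algebra_simps)
      then have p: "(x - x * t) powr (a - 1) = x powr (a - 1) * (1 - t) powr (a - 1)"
          "(x * t) powr (b - 1) = x powr (b - 1) * t powr (b - 1)"
        using x True by (simp_all add: powr_mult)
      have e: "exp (- \<mu> * (x - x * t)) * exp (- \<mu> * (x * t)) = exp (- \<mu> * x)"
        by (simp add: exp_add[symmetric] algebra_simps)
      have "x * (gamma_weight \<mu> a (x - x * t) * gamma_weight \<mu> b (x * t)) =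
          (x * (x powr (a - 1) * x powr (b - 1))) * (exp (- \<mu> * (x - x * t)) * exp (- \<mu> * (x * t))) /
              (Gamma a * Gamma b)
            * (t powr (b - 1) * (1 - t) powr (a - 1))"
        by (simp add: gamma_weight_def p)
      also have "\<dots> = c * (t powr (b - 1) * (1 - t) powr (a - 1))"
        by (simp only: xp e c_def)
      finally show ?thesis
        using x True c pos assms by (simp add: ennreal_mult[symmetric] gamma_weight_nonneg)
    next
      case False
      then show ?thesis
        using pos by (cases "t = 0 \<or> t = 1") (auto simp: indicator_def)
    qed
  qed
  also have "\<dots> = ennreal c * (\<integral>\<^sup>+t. ennreal (indicator {0..1} t *
      (t powr (b - 1) * (1 - t) powr (a - 1))) \<partial>lborel)"
    by (intro nn_integral_cmult) measurable
  also have "(\<integral>\<^sup>+t. ennreal (indicator {0..1} t * (t powr (b - 1) * (1 - t) powr (a - 1))) \<partial>lborel)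
      = ennreal (Beta b a)"
    using assms by (intro nn_integral_has_integral_lebesgue has_integral_Beta_real) auto
  also have "ennreal c * ennreal (Beta b a) = ennreal (c * Beta b a)"
    using c by (simp add: ennreal_mult')
  also have "c * Beta b a = gamma_weight \<mu> (a + b) x"
    using Gamma_pos by (simp add: c_def Beta_def gamma_weight_def add.commute mult.commute)
  finally show ?thesis using x by simp
qed

text \<open>
  The sum of independent gamma variables of shapes \<open>a\<close> and \<open>b\<close> is a gamma variable of shape \<open>a + b\<close>. So the
  measure of density \<open>gamma_weight \<mu> (a + b)\<close> is the image of a product measure under addition, and
  integrability on the right-hand side gives integrability of the double integral.
\<close>

lemma gamma_weight_convolution:
  fixes F :: "real \<Rightarrow> real"
  assumes ab: "a > 0" "b > 0" "\<mu> > 0"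
    and F [measurable]: "F \<in> borel_measurable borel"
    and int: "set_integrable lborel {0<..} (\<lambda>u. gamma_weight \<mu> (a + b) u * F u)"
  shows "(LINT w:{0<..}|lborel. gamma_weight \<mu> a w * (LINT w':{0<..}|lborel. gamma_weight \<mu> b w' *
      F (w + w')))
    = (LINT u:{0<..}|lborel. gamma_weight \<mu> (a + b) u * F u)"
proof -
  define g where "g c w = indicator {0<..} w * gamma_weight \<mu> c w" for c w :: real
  have [measurable]: "g c \<in> borel_measurable borel" for c
    unfolding g_def[abs_def] by measurable
  have g_nonneg: "g c w \<ge> 0" if "c > 0" for c w
    using that by (simp add: g_def gamma_weight_nonneg)
  have g_int: "integrable lborel (g c)" if "c > 0" for c
    using gamma_weight_integrable[OF that \<open>\<mu> > 0\<close>] by (simp add: g_def[abs_def] set_integrable_def)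
  have fin: "finite_measure (density lborel (g c))" if "c > 0" for c
  proof
    show "emeasure (density lborel (g c)) (space (density lborel (g c))) \<noteq> \<infinity>"
      using nn_integral_eq_integral[OF g_int[OF that]] g_nonneg[OF that]
      by (simp add: emeasure_density)
  qed
  have conv: "density lborel (g a) \<star> density lborel (g b) = density lborel (g (a + b))"
  proof -
    have "(\<lambda>x. \<integral>\<^sup>+y. ennreal (g a (x - y)) * ennreal (g b y) \<partial>lborel) = (\<lambda>x. ennreal (g (a + b) x))"
      unfolding g_def gamma_weight_convolution_pointwise[OF ab(1,2)] ..
    then show ?thesis
      using ab by (subst convolution_density) (simp_all add: fin)
  qed
  interpret A: finite_measure "density lborel (g a)" by (rule fin[OF ab(1)])
  interpret B: finite_measure "density lborel (g b)" by (rule fin[OF ab(2)])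
  interpret P: pair_sigma_finite "density lborel (g a)" "density lborel (g b)" ..
  have dens: "integral\<^sup>L (density lborel (g c)) f = (LINT w:{0<..}|lborel. gamma_weight \<mu> c w * f w)"
    if "c > 0" "f \<in> borel_measurable borel" for c and f :: "real \<Rightarrow> real"
  proof -
    have "integral\<^sup>L (density lborel (g c)) f = (\<integral>w. g c w *\<^sub>R f w \<partial>lborel)"
      using that by (intro integral_density) (simp_all add: g_nonneg)
    then show ?thesis
      by (simp add: set_lebesgue_integral_def g_def mult.assoc)
  qed
  have add_meas: "(\<lambda>(x, y). x + y) \<in> density lborel (g a) \<Otimes>\<^sub>M density lborel (g b)
      \<rightarrow>\<^sub>M (borel :: real measure)"
    by simp
  have "integrable (density lborel (g (a + b))) F"
  proof (subst integrable_density)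
    show "AE u in lborel. 0 \<le> g (a + b) u"
      using ab by (simp add: g_nonneg)
    show "integrable lborel (\<lambda>u. g (a + b) u *\<^sub>R F u)"
      using int by (simp add: g_def set_integrable_def mult.assoc)
  qed simp_all
  then have "integrable (density lborel (g a) \<Otimes>\<^sub>M density lborel (g b)) (\<lambda>p. F (case p of (x, y) \<Rightarrow> x + y))"
    unfolding conv[symmetric] convolution_def by (subst (asm) integrable_distr_eq[OF add_meas]) simp_all
  then have int2: "integrable (density lborel (g a) \<Otimes>\<^sub>M density lborel (g b)) (case_prod (\<lambda>x y. F (x + y)))"
    by (simp add: case_prod_beta')
  have "(LINT u:{0<..}|lborel. gamma_weight \<mu> (a + b) u * F u) = integral\<^sup>L (density lborel (g (a + b))) F"
    using ab by (subst dens) simp_all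
  also have "\<dots> = (\<integral>p. F (case p of (x, y) \<Rightarrow> x + y) \<partial>(density lborel (g a) \<Otimes>\<^sub>M density lborel (g b)))"
    unfolding conv[symmetric] convolution_def by (subst integral_distr[OF add_meas]) simp_all
  also have "\<dots> = (\<integral>x. (\<integral>y. F (x + y) \<partial>density lborel (g b)) \<partial>density lborel (g a))"
    using P.integral_fst[OF int2] by (simp add: case_prod_beta')
  also have "\<dots> = (LINT w:{0<..}|lborel. gamma_weight \<mu> a w *
      (LINT w':{0<..}|lborel. gamma_weight \<mu> b w' * F (w + w')))"
  proof (subst dens[OF ab(1)])
    show "(\<lambda>x. \<integral>y. F (x + y) \<partial>density lborel (g b)) \<in> borel_measurable borel"
      by measurable
  qed (simp add: dens[OF ab(2)])
  finally show ?thesis by simp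
qed

lemma white_noise_weighted_ms_integral:
  fixes c :: "real \<Rightarrow> real"
  assumes noise: "gaussian_white_noise M \<sigma> E"
    and A: "A \<in> sets borel"
    and meas [measurable]: "case_prod k \<in> borel_measurable (borel \<Otimes>\<^sub>M borel)" "c \<in> borel_measurable borel"
    and L2: "\<And>w. w \<in> A \<Longrightarrow> k w \<in> L2 lborel"
    and int: "set_integrable lborel A (\<lambda>w. \<bar>c w\<bar> * norm2 lborel (k w))"
  shows "has_ms_integral M A (\<lambda>w \<omega>. c w * E (k w) \<omega>) (E (\<lambda>s. LINT w:A|lborel. c w * k w s))"
proof (rule has_ms_integral_cong_AE)
  have "case_prod (\<lambda>w s. c w * k w s) \<in> borel_measurable (borel \<Otimes>\<^sub>M borel)"
    by measurable
  moreover have "set_integrable lborel A (\<lambda>w. norm2 lborel (\<lambda>s. c w * k w s))"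
    using int by (simp add: norm2_scale)
  ultimately show int': "has_ms_integral M A (\<lambda>w. E (\<lambda>s. c w * k w s))
      (E (\<lambda>s. LINT w:A|lborel. c w * k w s))"
    using L2 by (intro white_noise_ms_integral[OF noise A] L2_scale)
  then show "E (\<lambda>s. LINT w:A|lborel. c w * k w s) \<in> L2 M"
    by (simp add: has_ms_integral_def)
  fix w assume w: "w \<in> A"
  show "(\<lambda>\<omega>. c w * E (k w) \<omega>) \<in> L2 M"
    by (rule L2_scale[OF white_noise_L2[OF noise L2[OF w]]])
  show "AE \<omega> in M. c w * E (k w) \<omega> = E (\<lambda>s. c w * k w s) \<omega>"
    using white_noise_scale[OF noise L2[OF w], of "c w"] by auto
qed simp

lemma has_ms_integral_pairing:
  "has_ms_integral M A Y Z \<Longrightarrow> V \<in> L2 M \<Longrightarrow>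
    (\<integral>\<omega>. Z \<omega> * V \<omega> \<partial>M) = (LINT w:A|lborel. (\<integral>\<omega>. Y w \<omega> * V \<omega> \<partial>M))"
  by (simp add: has_ms_integral_def)

section \<open>Heat flow and Bessel potentials\<close>

lemma test_function_bounded_integrable:
  assumes "\<phi> \<in> test_functions"
  obtains B where "\<phi> \<in> borel_measurable borel" "integrable lborel \<phi>" "\<phi> \<in> L2 lborel"
    "B \<ge> 0" "\<And>x. \<bar>\<phi> x\<bar> \<le> B"
proof -
  obtain R where cont: "continuous_on UNIV \<phi>" and R: "\<And>x. \<bar>x\<bar> > R \<Longrightarrow> \<phi> x = 0"
    using assms by (auto simp: test_functions_def)
  have "compact (\<phi> ` {-R..R})"
    by (intro compact_continuous_image continuous_on_subset[OF cont]) auto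
  then obtain B where B: "\<And>y. y \<in> \<phi> ` {-R..R} \<Longrightarrow> norm y \<le> B"
    using compact_imp_bounded bounded_iff by metis
  have bound: "\<bar>\<phi> x\<bar> \<le> max B 0" for x
  proof (cases "\<bar>x\<bar> > R")
    case True then show ?thesis by (simp add: R)
  next
    case False
    then have "norm (\<phi> x) \<le> B" by (intro B imageI) auto
    then show ?thesis by simp
  qed
  have ind: "(\<lambda>x. indicator {-R..R} x *\<^sub>R f x) = f" if "\<And>x. \<bar>x\<bar> > R \<Longrightarrow> f x = 0" for f :: "real \<Rightarrow> real"
  proof
    fix x show "indicator {-R..R} x *\<^sub>R f x = f x"
      using that[of x] by (cases "\<bar>x\<bar> > R") (auto simp: indicator_def)
  qed
  have meas: "\<phi> \<in> borel_measurable borel"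
    using cont by (rule borel_measurable_continuous_onI)
  have "set_integrable lborel {-R..R} \<phi>" "set_integrable lborel {-R..R} (\<lambda>x. (\<phi> x)\<^sup>2)"
    by (intro borel_integrable_atLeastAtMost' continuous_on_power continuous_on_subset[OF cont]; simp)+
  moreover have "(\<lambda>x. indicator {-R..R} x *\<^sub>R \<phi> x) = \<phi>"
    "(\<lambda>x. indicator {-R..R} x *\<^sub>R (\<phi> x)\<^sup>2) = (\<lambda>x. (\<phi> x)\<^sup>2)"
    by (rule ind, simp add: R)+
  ultimately have "integrable lborel \<phi>" "integrable lborel (\<lambda>x. (\<phi> x)\<^sup>2)"
    by (simp_all only: set_integrable_def)
  then show ?thesis
    using that[of "max B 0"] meas bound by (simp add: L2_def)
qed

lemma L2_translate:
  fixes f :: "real \<Rightarrow> real"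
  assumes "f \<in> L2 lborel"
  shows "(\<lambda>s. f (s - x)) \<in> L2 lborel" and "norm2 lborel (\<lambda>s. f (s - x)) = norm2 lborel f"
proof -
  have [measurable]: "f \<in> borel_measurable borel"
    using L2_measurable[OF assms] by simp
  show "(\<lambda>s. f (s - x)) \<in> L2 lborel"
    using lborel_integrable_real_affine[OF L2_square_integrable[OF assms], of 1 "- x"]
    by (simp add: L2_def)
  show "norm2 lborel (\<lambda>s. f (s - x)) = norm2 lborel f"
    using lborel_integral_real_affine[of 1 "\<lambda>s. (f s)\<^sup>2" "- x"] by (simp add: norm2_def)
qed

definition heat_flow :: "real \<Rightarrow> (real \<Rightarrow> real) \<Rightarrow> real \<Rightarrow> real" where
  "heat_flow w \<phi> s = (\<integral>t. \<phi> t * heat_kernel (s - t) w \<partial>lborel)"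

lemma heat_flow_translates: "heat_flow w \<phi> s = (\<integral>x. heat_kernel x w * \<phi> (s - x) \<partial>lborel)"
  using lborel_integral_real_affine[of "-1" "\<lambda>t. \<phi> t * heat_kernel (s - t) w" s]
  by (simp add: heat_flow_def mult.commute)

text \<open>
  As an average of translates of \<open>\<phi>\<close> with total weight \<open>1\<close>, the heat flow does not increase the norm.
\<close>

lemma heat_flow_L2:
  assumes \<phi>: "\<phi> \<in> test_functions" and w: "w > 0"
  shows "heat_flow w \<phi> \<in> L2 lborel" and "norm2 lborel (heat_flow w \<phi>) \<le> norm2 lborel \<phi>"
proof -
  have [measurable]: "\<phi> \<in> borel_measurable borel" and L2: "\<phi> \<in> L2 lborel"
    using test_function_bounded_integrable[OF \<phi>] by metis+
  have eq: "(\<lambda>s. LINT x:UNIV|lborel. heat_kernel x w * \<phi> (s - x)) = heat_flow w \<phi>"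
    by (simp add: heat_flow_translates fun_eq_iff set_lebesgue_integral_def)
  have norm_eq: "norm2 lborel (\<lambda>s. heat_kernel x w * \<phi> (s - x)) = heat_kernel x w * norm2 lborel \<phi>" for x
    using w by (simp add: norm2_scale L2_translate[OF L2] heat_kernel_nonneg)
  have int: "set_integrable lborel UNIV (\<lambda>x. norm2 lborel (\<lambda>s. heat_kernel x w * \<phi> (s - x)))"
    using w by (simp add: norm_eq heat_kernel_integrable set_integrable_def)
  have meas: "case_prod (\<lambda>x s. heat_kernel x w * \<phi> (s - x)) \<in> borel_measurable (borel \<Otimes>\<^sub>M borel)"
    by measurable
  note Minkowski = L2_set_integral_Minkowski(1,2)[OF _ meas L2_scale[OF L2_translate(1)[OF L2]] int,
      unfolded eq norm_eq]
  show "heat_flow w \<phi> \<in> L2 lborel"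
    using Minkowski(1) by simp
  show "norm2 lborel (heat_flow w \<phi>) \<le> norm2 lborel \<phi>"
    using Minkowski(2) w by (simp add: set_lebesgue_integral_def heat_kernel_integral)
qed

text \<open>
  Translates of the noise are averaged with weight \<open>heat_kernel x w\<close>; by duality this is the noise tested
  against the same average of translates of \<open>\<phi>\<close>.
\<close>

lemma white_noise_heat_semigroup:
  assumes noise: "gaussian_white_noise M \<sigma> E" and \<phi>: "\<phi> \<in> test_functions" and w: "w > 0"
  shows "has_ms_integral M UNIV (\<lambda>x \<omega>. heat_kernel x w * shift x E \<phi> \<omega>) (E (heat_flow w \<phi>))"
proof -
  have [measurable]: "\<phi> \<in> borel_measurable borel" and L2: "\<phi> \<in> L2 lborel"
    using test_function_bounded_integrable[OF \<phi>] by metis+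
  have eq: "(\<lambda>s. LINT x:UNIV|lborel. heat_kernel x w * \<phi> (s - x)) = heat_flow w \<phi>"
    by (simp add: heat_flow_translates fun_eq_iff set_lebesgue_integral_def)
  have int: "set_integrable lborel UNIV (\<lambda>x. \<bar>heat_kernel x w\<bar> * norm2 lborel (\<lambda>s. \<phi> (s - x)))"
    using w by (simp add: L2_translate[OF L2] heat_kernel_integrable set_integrable_def)
  have meas: "case_prod (\<lambda>x s. \<phi> (s - x)) \<in> borel_measurable (borel \<Otimes>\<^sub>M borel)"
      "(\<lambda>x. heat_kernel x w) \<in> borel_measurable borel"
    by measurable
  show ?thesis
    using white_noise_weighted_ms_integral[OF noise _ meas L2_translate(1)[OF L2] int, unfolded eq]
    by (simp add: shift_def)
qed

text \<open>
  The same random variable arises when the noise is first tested against heat kernels centred at \<open>t\<close>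
  and then averaged over \<open>t\<close> with weight \<open>\<phi> t\<close>. In this form covariances become integrals of heat kernels.
\<close>

lemma white_noise_heat_kernel_average:
  assumes noise: "gaussian_white_noise M \<sigma> E" and \<phi>: "\<phi> \<in> test_functions" and w: "w > 0"
  shows "has_ms_integral M UNIV (\<lambda>t \<omega>. \<phi> t * shift t E (\<lambda>x. heat_kernel x w) \<omega>) (E (heat_flow w \<phi>))"
proof -
  have [measurable]: "\<phi> \<in> borel_measurable borel" and I: "integrable lborel \<phi>"
    using test_function_bounded_integrable[OF \<phi>] by metis+
  have eq: "(\<lambda>s. LINT t:UNIV|lborel. \<phi> t * heat_kernel (s - t) w) = heat_flow w \<phi>"
    by (simp add: heat_flow_def fun_eq_iff set_lebesgue_integral_def)
  have int: "set_integrable lborel UNIV (\<lambda>t. \<bar>\<phi> t\<bar> * norm2 lborel (\<lambda>s. heat_kernel (s - t) w))"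
    using w I by (simp add: norm2_heat_kernel set_integrable_def)
  have meas: "case_prod (\<lambda>t s. heat_kernel (s - t) w) \<in> borel_measurable (borel \<Otimes>\<^sub>M borel)"
      "\<phi> \<in> borel_measurable borel"
    by measurable
  show ?thesis
    using white_noise_weighted_ms_integral[OF noise _ meas heat_kernel_L2[OF w] int] eq
    by (simp add: shift_def)
qed

text \<open>
  The function \<open>(\<mu> - d\<^sup>2/dt\<^sup>2)\<^sup>-\<^sup>\<beta> \<phi>\<close>.
\<close>

definition bessel_potential :: "real \<Rightarrow> real \<Rightarrow> (real \<Rightarrow> real) \<Rightarrow> real \<Rightarrow> real" where
  "bessel_potential \<mu> \<beta> \<phi> s = (LINT w:{0<..}|lborel. gamma_weight \<mu> \<beta> w * heat_flow w \<phi> s)"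

text \<open>
  The convolution kernel of \<open>(\<mu> - d\<^sup>2/dt\<^sup>2)\<^sup>-\<^sup>\<beta>\<close>. For \<open>\<beta> \<le> 1/2\<close> the integral diverges at \<open>x = 0\<close>, and the value
  there is \<open>0\<close>, the default of the Lebesgue integral.
\<close>

definition bessel_potential_kernel :: "real \<Rightarrow> real \<Rightarrow> real \<Rightarrow> real" where
  "bessel_potential_kernel \<mu> \<beta> x = (LINT w:{0<..}|lborel. gamma_weight \<mu> \<beta> w * heat_kernel x w)"

lemma borel_measurable_bessel_potential_kernel [measurable (raw)]:
  assumes [measurable]: "f \<in> borel_measurable M"
  shows "(\<lambda>x. bessel_potential_kernel \<mu> \<beta> (f x)) \<in> borel_measurable M"
proof -
  have "bessel_potential_kernel \<mu> \<beta> \<in> borel_measurable borel"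
    unfolding bessel_potential_kernel_def[abs_def] set_lebesgue_integral_def by measurable
  then show ?thesis by measurable
qed

context
  fixes \<mu> \<beta> :: real and \<phi> :: "real \<Rightarrow> real"
  assumes pos: "\<mu> > 0" "\<beta> > 0" and \<phi>: "\<phi> \<in> test_functions"
begin

lemma heat_flow_weighted_norm_integrable:
  "set_integrable lborel {0<..} (\<lambda>w. \<bar>gamma_weight \<mu> \<beta> w\<bar> * norm2 lborel (heat_flow w \<phi>))"
proof (intro set_integrable_bound[OF set_integrable_mult_left[OF gamma_weight_integrable]] AE_I2 impI)
  have [measurable]: "\<phi> \<in> borel_measurable borel"
    using test_function_bounded_integrable[OF \<phi>] by metis
  have [measurable]: "(\<lambda>w. norm2 lborel (heat_flow w \<phi>)) \<in> borel_measurable lborel"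
    unfolding norm2_def heat_flow_def by measurable
  show "set_borel_measurable lborel {0<..} (\<lambda>w. \<bar>gamma_weight \<mu> \<beta> w\<bar> * norm2 lborel (heat_flow w \<phi>))"
    unfolding set_borel_measurable_def by measurable
  fix w :: real assume "w \<in> {0<..}"
  then show "norm (\<bar>gamma_weight \<mu> \<beta> w\<bar> * norm2 lborel (heat_flow w \<phi>))
      \<le> norm (gamma_weight \<mu> \<beta> w * norm2 lborel \<phi>)"
    using heat_flow_L2(2)[OF \<phi>, of w] by (auto simp: abs_mult intro!: mult_left_mono)
qed (use pos in auto)

lemma borel_measurable_heat_flow:
  "case_prod (\<lambda>w s. heat_flow w \<phi> s) \<in> borel_measurable (borel \<Otimes>\<^sub>M borel)"
proof -
  have [measurable]: "\<phi> \<in> borel_measurable borel"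
    using test_function_bounded_integrable[OF \<phi>] by metis
  show ?thesis
    unfolding heat_flow_def by measurable
qed

lemma bessel_potential_L2: "bessel_potential \<mu> \<beta> \<phi> \<in> L2 lborel"
proof -
  note [measurable] = borel_measurable_heat_flow
  have "case_prod (\<lambda>w s. gamma_weight \<mu> \<beta> w * heat_flow w \<phi> s) \<in> borel_measurable (borel \<Otimes>\<^sub>M borel)"
    by measurable
  then show ?thesis
    unfolding bessel_potential_def[abs_def]
    using heat_flow_weighted_norm_integrable heat_flow_L2(1)[OF \<phi>]
    by (intro L2_set_integral_Minkowski(1) L2_scale) (simp_all add: norm2_scale)
qed

lemma bessel_potential_ms_integral:
  assumes noise: "gaussian_white_noise M \<sigma> E"
  shows "has_ms_integral M {0<..} (\<lambda>w \<omega>. gamma_weight \<mu> \<beta> w * E (heat_flow w \<phi>) \<omega>)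
      (E (bessel_potential \<mu> \<beta> \<phi>))"
  unfolding bessel_potential_def[abs_def]
  using heat_flow_weighted_norm_integrable heat_flow_L2(1)[OF \<phi>] borel_measurable_heat_flow
  by (intro white_noise_weighted_ms_integral[OF noise]) simp_all

end

context
  fixes \<mu> \<beta> :: real
  assumes pos: "\<mu> > 0" "\<beta> > 1 / 4"
begin

lemma heat_kernel_weighted_norm_integrable:
  "set_integrable lborel {0<..} (\<lambda>w. \<bar>gamma_weight \<mu> \<beta> w\<bar> * norm2 lborel (\<lambda>s. heat_kernel (s - t) w))"
  using gamma_weight_sqrt_heat_kernel_integrable[OF pos(2,1)]
  by (rule set_integrable_cong[OF refl refl, THEN iffD1, rotated])
     (use pos in \<open>simp add: norm2_heat_kernel gamma_weight_nonneg\<close>)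

lemma bessel_potential_kernel_L2: "(\<lambda>s. bessel_potential_kernel \<mu> \<beta> (s - t)) \<in> L2 lborel"
proof -
  have "case_prod (\<lambda>w s. gamma_weight \<mu> \<beta> w * heat_kernel (s - t) w) \<in> borel_measurable (borel \<Otimes>\<^sub>M borel)"
    by measurable
  then show ?thesis
    unfolding bessel_potential_kernel_def
    using heat_kernel_weighted_norm_integrable[of t] heat_kernel_L2
    by (intro L2_set_integral_Minkowski(1) L2_scale) (simp_all add: norm2_scale)
qed

lemma bessel_potential_kernel_ms_integral:
  assumes noise: "gaussian_white_noise M \<sigma> E"
  shows "has_ms_integral M {0<..} (\<lambda>w \<omega>. gamma_weight \<mu> \<beta> w * shift t E (\<lambda>x. heat_kernel x w) \<omega>)
          (E (\<lambda>s. bessel_potential_kernel \<mu> \<beta> (s - t)))"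
proof -
  have meas: "case_prod (\<lambda>w s. heat_kernel (s - t) w) \<in> borel_measurable (borel \<Otimes>\<^sub>M borel)"
      "gamma_weight \<mu> \<beta> \<in> borel_measurable borel"
    by measurable
  show ?thesis
    using white_noise_weighted_ms_integral[OF noise _ meas _
        heat_kernel_weighted_norm_integrable[of t]] heat_kernel_L2[of _ t]
    by (simp add: bessel_potential_kernel_def shift_def)
qed

end

section \<open>The Bessel potential kernel\<close>

text \<open>
  A bound on the heat kernel integrals that is uniform in \<open>u\<close> suffices for Fubini's theorem, since the
  gamma weight is integrable. The lemma serves for the convolution with a test function, for the
  Fourier transform and for the double integral in the generalized covariance.
\<close>

lemma bessel_potential_kernel_Fubini:
  fixes f :: "'p \<Rightarrow> 'e :: {banach, second_countable_topology}" and d :: "'p \<Rightarrow> real"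
  assumes pos: "\<mu> > 0" "\<beta> > 0" and "sigma_finite_measure Q"
    and meas [measurable]: "f \<in> borel_measurable Q" "d \<in> borel_measurable Q"
    and int: "\<And>u. u > 0 \<Longrightarrow> integrable Q (\<lambda>p. heat_kernel (d p) u *\<^sub>R f p)"
    and bound: "\<And>u. u > 0 \<Longrightarrow> (\<integral>p. heat_kernel (d p) u * norm (f p) \<partial>Q) \<le> K"
  shows "integrable Q (\<lambda>p. bessel_potential_kernel \<mu> \<beta> (d p) *\<^sub>R f p)"
    and "set_integrable lborel {0<..} (\<lambda>u. gamma_weight \<mu> \<beta> u *\<^sub>R (\<integral>p. heat_kernel (d p) u *\<^sub>R f p \<partial>Q))"
    and "(\<integral>p. bessel_potential_kernel \<mu> \<beta> (d p) *\<^sub>R f p \<partial>Q) =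
      (LINT u:{0<..}|lborel. gamma_weight \<mu> \<beta> u *\<^sub>R (\<integral>p. heat_kernel (d p) u *\<^sub>R f p \<partial>Q))"
proof -
  interpret Q: sigma_finite_measure Q by fact
  interpret pair_sigma_finite lborel Q ..
  define c where "c u = indicator {0<..} u * gamma_weight \<mu> \<beta> u" for u
  define F where "F u p = (c u * heat_kernel (d p) u) *\<^sub>R f p" for u p
  have [measurable]: "c \<in> borel_measurable borel"
    unfolding c_def[abs_def] by measurable
  have [measurable]: "case_prod F \<in> borel_measurable (lborel \<Otimes>\<^sub>M Q)"
    unfolding F_def by measurable
  have c: "c u \<ge> 0" "u \<le> 0 \<Longrightarrow> c u = 0" for u
    using pos by (simp_all add: c_def gamma_weight_nonneg)
  have ch: "c u * heat_kernel x u \<ge> 0" for u x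
    using c[of u] heat_kernel_nonneg[of u x] by (cases "u > 0") auto
  have norm_F: "norm (F u p) = c u * (heat_kernel (d p) u * norm (f p))" for u p
    using ch[of u "d p"] by (simp add: F_def)
  have joint: "integrable (lborel \<Otimes>\<^sub>M Q) (case_prod F)"
  proof (rule Fubini_integrable)
    show "AE u in lborel. integrable Q (\<lambda>p. case (u, p) of (u, p) \<Rightarrow> F u p)"
    proof (rule AE_I2)
      fix u :: real
      show "integrable Q (\<lambda>p. case (u, p) of (u, p) \<Rightarrow> F u p)"
        using integrable_scaleR_right[OF int[of u], of "c u"] c(2)[of u]
        by (cases "u > 0") (simp_all add: F_def)
    qed
    have "integrable lborel (\<lambda>u. c u * K)"
      using gamma_weight_integrable[OF pos(2,1)] by (simp add: c_def set_integrable_def)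
    then show "integrable lborel (\<lambda>u. \<integral>p. norm (case (u, p) of (u, p) \<Rightarrow> F u p) \<partial>Q)"
    proof (rule Bochner_Integration.integrable_bound)
      show "AE u in lborel. norm (\<integral>p. norm (case (u, p) of (u, p) \<Rightarrow> F u p) \<partial>Q) \<le> norm (c u * K)"
      proof (rule AE_I2)
        fix u :: real
        have "(\<integral>p. norm (F u p) \<partial>Q) = c u * (\<integral>p. heat_kernel (d p) u * norm (f p) \<partial>Q)"
          unfolding norm_F by simp
        also have "\<dots> \<le> c u * K"
          using bound[of u] c[of u] by (cases "u > 0") (auto intro: mult_left_mono)
        finally have "(\<integral>p. norm (F u p) \<partial>Q) \<le> c u * K" .
        then show "norm (\<integral>p. norm (case (u, p) of (u, p) \<Rightarrow> F u p) \<partial>Q) \<le> norm (c u * K)"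
          by (simp add: abs_of_nonneg)
      qed
    qed measurable
  qed measurable
  have inner: "(\<integral>p. F u p \<partial>Q) = c u *\<^sub>R (\<integral>p. heat_kernel (d p) u *\<^sub>R f p \<partial>Q)" for u
    by (simp add: F_def scaleR_scaleR[symmetric] del: scaleR_scaleR)
  show "set_integrable lborel {0<..} (\<lambda>u. gamma_weight \<mu> \<beta> u *\<^sub>R (\<integral>p. heat_kernel (d p) u *\<^sub>R f p \<partial>Q))"
    using integrable_fst[OF joint] unfolding inner by (simp add: set_integrable_def c_def)
  (* At a point p where f p is nonzero and the integral defining the kernel diverges,
     the sections of F are not integrable; such points form a null set. *)
  have outer: "AE p in Q. (\<integral>u. F u p \<partial>lborel) = bessel_potential_kernel \<mu> \<beta> (d p) *\<^sub>R f p"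
    using AE_integrable_snd[OF joint]
  proof eventually_elim
    case (elim p)
    show ?case
    proof (cases "f p = 0")
      case False
      have "integrable lborel (\<lambda>u. (c u * heat_kernel (d p) u) * norm (f p))"
        using integrable_norm[OF elim] by (simp add: norm_F mult.assoc)
      then have "integrable lborel (\<lambda>u. c u * heat_kernel (d p) u)"
        using False by simp
      then show ?thesis
        by (simp add: F_def bessel_potential_kernel_def set_lebesgue_integral_def c_def mult.assoc)
    qed (simp add: F_def)
  qed
  show "integrable Q (\<lambda>p. bessel_potential_kernel \<mu> \<beta> (d p) *\<^sub>R f p)"
    using integrable_snd[OF joint] outer by (subst integrable_cong_AE[symmetric]) auto
  have "(\<integral>p. bessel_potential_kernel \<mu> \<beta> (d p) *\<^sub>R f p \<partial>Q) = (\<integral>p. (\<integral>u. F u p \<partial>lborel) \<partial>Q)"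
    using outer by (intro integral_cong_AE) auto
  also have "\<dots> = (\<integral>u. (\<integral>p. F u p \<partial>Q) \<partial>lborel)"
    by (rule Fubini_integral[OF joint])
  finally show "(\<integral>p. bessel_potential_kernel \<mu> \<beta> (d p) *\<^sub>R f p \<partial>Q) =
      (LINT u:{0<..}|lborel. gamma_weight \<mu> \<beta> u *\<^sub>R (\<integral>p. heat_kernel (d p) u *\<^sub>R f p \<partial>Q))"
    unfolding inner by (simp add: set_lebesgue_integral_def c_def)
qed

lemma heat_kernel_bounded_integrable:
  fixes f :: "real \<Rightarrow> real"
  assumes w: "w > 0" and [measurable]: "f \<in> borel_measurable borel" and B: "\<And>x. \<bar>f x\<bar> \<le> B"
  shows "integrable lborel (\<lambda>s. heat_kernel (t - s) w * f s)"
    and "(\<integral>s. heat_kernel (t - s) w * \<bar>f s\<bar> \<partial>lborel) \<le> B"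
proof -
  have dom: "integrable lborel (\<lambda>s. B * heat_kernel (t - s) w)"
    using heat_kernel_shift_integrable[OF w] by simp
  have le: "heat_kernel (t - s) w * \<bar>f s\<bar> \<le> B * heat_kernel (t - s) w" for s
    using mult_left_mono[OF B[of s] heat_kernel_nonneg[OF w, of "t - s"]] by (simp add: mult.commute)
  have B_nonneg: "B \<ge> 0"
    using B[of 0] by linarith
  show "integrable lborel (\<lambda>s. heat_kernel (t - s) w * f s)"
    using le w B_nonneg
    by (intro Bochner_Integration.integrable_bound[OF dom]) (auto simp: abs_mult heat_kernel_nonneg)
  then have "integrable lborel (\<lambda>s. heat_kernel (t - s) w * \<bar>f s\<bar>)"
    by (rule Bochner_Integration.integrable_bound) (use w in \<open>auto simp: abs_mult heat_kernel_nonneg\<close>)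
  then have "(\<integral>s. heat_kernel (t - s) w * \<bar>f s\<bar> \<partial>lborel) \<le> (\<integral>s. B * heat_kernel (t - s) w \<partial>lborel)"
    using le by (intro integral_mono dom) auto
  also have "\<dots> = B"
    using w by (simp add: heat_kernel_shift_integral)
  finally show "(\<integral>s. heat_kernel (t - s) w * \<bar>f s\<bar> \<partial>lborel) \<le> B" .
qed

lemma bessel_potential_eq_convolution:
  assumes pos: "\<mu> > 0" "\<beta> > 0" and \<phi>: "\<phi> \<in> test_functions"
  shows "bessel_potential \<mu> \<beta> \<phi> s = (\<integral>t. \<phi> t * bessel_potential_kernel \<mu> \<beta> (s - t) \<partial>lborel)"
proof -
  obtain B where [measurable]: "\<phi> \<in> borel_measurable borel" and B: "\<And>x. \<bar>\<phi> x\<bar> \<le> B"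
    using test_function_bounded_integrable[OF \<phi>] by metis
  have "(\<integral>t. bessel_potential_kernel \<mu> \<beta> (s - t) *\<^sub>R \<phi> t \<partial>lborel) =
      (LINT u:{0<..}|lborel. gamma_weight \<mu> \<beta> u *\<^sub>R (\<integral>t. heat_kernel (s - t) u *\<^sub>R \<phi> t \<partial>lborel))"
    using heat_kernel_bounded_integrable[OF _ _ B] pos
    by (intro bessel_potential_kernel_Fubini(3)[where K = B])
        (simp_all add: lborel.sigma_finite_measure_axioms)
  then show ?thesis
    by (simp add: bessel_potential_def heat_flow_def mult.commute)
qed

lemma bessel_potential_kernel_integrable:
  assumes "\<mu> > 0" "\<beta> > 0"
  shows "integrable lborel (bessel_potential_kernel \<mu> \<beta>)"
  using bessel_potential_kernel_Fubini(1)[OF assms, of lborel "\<lambda>_. 1 :: real" "\<lambda>x. x" 1]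
  by (simp add: lborel.sigma_finite_measure_axioms heat_kernel_integrable heat_kernel_integral)

text \<open>
  The transform of the heat kernel is \<open>exp (- u \<tau>\<^sup>2)\<close>, which changes the parameter \<open>\<mu>\<close> of the gamma weight
  to \<open>\<mu> + \<tau>\<^sup>2\<close>.
\<close>

lemma bessel_potential_kernel_Fourier:
  assumes pos: "\<mu> > 0" "\<beta> > 0"
  shows "(\<integral>h. exp (\<i> * complex_of_real (\<tau> * h)) * complex_of_real (bessel_potential_kernel \<mu> \<beta> h) \<partial>lborel)
    = complex_of_real ((\<mu> + \<tau>\<^sup>2) powr (- \<beta>))"
proof -
  define f where "f h = exp (\<i> * complex_of_real (\<tau> * h))" for h
  have [measurable]: "f \<in> borel_measurable borel"
    unfolding f_def[abs_def] by measurable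
  have norm_f: "norm (f h) = 1" for h
    by (simp add: f_def)
  have int: "integrable lborel (\<lambda>h. heat_kernel h u *\<^sub>R f h)" if u: "u > 0" for u
    by (rule Bochner_Integration.integrable_bound[OF heat_kernel_integrable[OF u]]) (auto simp: norm_f)
  have "(\<integral>h. exp (\<i> * complex_of_real (\<tau> * h)) * complex_of_real (bessel_potential_kernel \<mu> \<beta> h) \<partial>lborel)
      = (\<integral>h. bessel_potential_kernel \<mu> \<beta> h *\<^sub>R f h \<partial>lborel)"
    by (simp add: f_def scaleR_conv_of_real mult.commute)
  also have "\<dots> = (LINT u:{0<..}|lborel. gamma_weight \<mu> \<beta> u *\<^sub>R (\<integral>h. heat_kernel h u *\<^sub>R f h \<partial>lborel))"
    using pos int
    by (intro bessel_potential_kernel_Fubini(3)[where K = 1])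
       (simp_all add: lborel.sigma_finite_measure_axioms norm_f heat_kernel_integral)
  also have "\<dots> = (LINT u:{0<..}|lborel. complex_of_real (1 / Gamma \<beta> *
      (u powr (\<beta> - 1) * exp (- (\<mu> + \<tau>\<^sup>2) * u))))"
  proof (rule set_lebesgue_integral_cong)
    show "\<forall>u. u \<in> {0<..} \<longrightarrow> gamma_weight \<mu> \<beta> u *\<^sub>R (\<integral>h. heat_kernel h u *\<^sub>R f h \<partial>lborel) =
        complex_of_real (1 / Gamma \<beta> * (u powr (\<beta> - 1) * exp (- (\<mu> + \<tau>\<^sup>2) * u)))"
    proof (intro allI impI)
      fix u :: real assume u: "u \<in> {0<..}"
      have "(\<integral>h. heat_kernel h u *\<^sub>R f h \<partial>lborel) = complex_of_real (exp (- (u * \<tau>\<^sup>2)))"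
        using heat_kernel_Fourier[of u \<tau>] u by (simp add: f_def scaleR_conv_of_real mult.commute)
      moreover have "exp (- (\<mu> + \<tau>\<^sup>2) * u) = exp (- \<mu> * u) * exp (- (u * \<tau>\<^sup>2))"
        by (simp add: exp_add[symmetric] algebra_simps)
      ultimately show "gamma_weight \<mu> \<beta> u *\<^sub>R (\<integral>h. heat_kernel h u *\<^sub>R f h \<partial>lborel) =
          complex_of_real (1 / Gamma \<beta> * (u powr (\<beta> - 1) * exp (- (\<mu> + \<tau>\<^sup>2) * u)))"
        by (simp add: gamma_weight_def scaleR_conv_of_real)
    qed
  qed simp
  also have "\<dots> = complex_of_real (LINT u:{0<..}|lborel. 1 / Gamma \<beta> *
      (u powr (\<beta> - 1) * exp (- (\<mu> + \<tau>\<^sup>2) * u)))"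
    by (rule set_integral_complex_of_real)
  also have "(LINT u:{0<..}|lborel. 1 / Gamma \<beta> * (u powr (\<beta> - 1) * exp (- (\<mu> + \<tau>\<^sup>2) * u)))
      = (\<mu> + \<tau>\<^sup>2) powr (- \<beta>)"
    using gamma_weight_integral[of \<beta> "\<mu> + \<tau>\<^sup>2"] pos
    by (simp only: gamma_weight_def add_pos_nonneg zero_le_power2)
  finally show ?thesis .
qed

text \<open>
  For \<open>\<beta> > 1/2\<close> the integrand at \<open>0\<close> is integrable and dominates all others.
\<close>

lemma bessel_potential_kernel_continuous_at_zero:
  assumes "\<mu> > 0" "\<beta> > 1 / 2"
  shows "(bessel_potential_kernel \<mu> \<beta> \<longlongrightarrow> bessel_potential_kernel \<mu> \<beta> 0) (at 0)"
  unfolding tendsto_at_iff_sequentially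
proof (intro allI impI)
  fix X :: "nat \<Rightarrow> real"
  assume "\<forall>i. X i \<in> UNIV - {0}" and X: "X \<longlonglongrightarrow> 0"
  have "(\<lambda>n. \<integral>w. indicator {0<..} w *\<^sub>R (gamma_weight \<mu> \<beta> w * heat_kernel (X n) w) \<partial>lborel) \<longlonglongrightarrow>
      (\<integral>w. indicator {0<..} w *\<^sub>R (gamma_weight \<mu> \<beta> w * heat_kernel 0 w) \<partial>lborel)"
  proof (rule integral_dominated_convergence)
    show "integrable lborel (\<lambda>w. indicator {0<..} w *\<^sub>R (gamma_weight \<mu> \<beta> w * heat_kernel 0 w))"
      using gamma_weight_heat_kernel_integrable[of \<beta> \<mu> 0] assms by (simp add: set_integrable_def)
    have "(\<lambda>n. heat_kernel (X n) w) \<longlonglongrightarrow> heat_kernel 0 w" if "w > 0" for w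
      unfolding heat_kernel_def using X that by (intro tendsto_intros) auto
    then have "(\<lambda>n. indicator {0<..} w *\<^sub>R (gamma_weight \<mu> \<beta> w * heat_kernel (X n) w)) \<longlonglongrightarrow>
        indicator {0<..} w *\<^sub>R (gamma_weight \<mu> \<beta> w * heat_kernel 0 w)" for w
      by (cases "w > 0") (auto intro!: tendsto_mult)
    then show "AE w in lborel. (\<lambda>n. indicator {0<..} w *\<^sub>R (gamma_weight \<mu> \<beta> w * heat_kernel (X n) w)) \<longlonglongrightarrow>
        indicator {0<..} w *\<^sub>R (gamma_weight \<mu> \<beta> w * heat_kernel 0 w)"
      by simp
    fix n
    have "norm (indicator {0<..} w *\<^sub>R (gamma_weight \<mu> \<beta> w * heat_kernel (X n) w)) \<le>
        indicator {0<..} w *\<^sub>R (gamma_weight \<mu> \<beta> w * heat_kernel 0 w)" for w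
      using heat_kernel_le_at_zero[of w "X n"] heat_kernel_nonneg[of w "X n"]
          gamma_weight_nonneg[of \<beta> \<mu> w] assms
      by (cases "w > 0") (auto simp: abs_mult intro!: mult_left_mono)
    then show "AE w in lborel. norm (indicator {0<..} w *\<^sub>R (gamma_weight \<mu> \<beta> w * heat_kernel (X n) w)) \<le>
        indicator {0<..} w *\<^sub>R (gamma_weight \<mu> \<beta> w * heat_kernel 0 w)"
      by simp
  qed measurable
  then show "(bessel_potential_kernel \<mu> \<beta> \<circ> X) \<longlonglongrightarrow> bessel_potential_kernel \<mu> \<beta> 0"
    by (simp add: bessel_potential_kernel_def[abs_def] set_lebesgue_integral_def o_def)
qed

lemma integral_even:
  fixes f :: "real \<Rightarrow> real"
  assumes int: "integrable lborel f" and even: "\<And>x. f (- x) = f x"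
  shows "(\<integral>x. f x \<partial>lborel) = 2 * (LINT x:{0..}|lborel. f x)"
proof -
  have [measurable]: "f \<in> borel_measurable borel"
    using int by (simp add: borel_measurable_integrable flip: measurable_lborel1)
  have half: "integrable lborel (\<lambda>x. indicator A x * f x)" if "A \<in> sets borel" for A
    using integrable_mult_indicator[OF _ int, of A] that by simp
  have "(\<integral>x. indicator {..<0} x * f x \<partial>lborel) = (\<integral>x. indicator {0<..} x * f x \<partial>lborel)"
    using lborel_integral_real_affine[of "-1" "\<lambda>x. indicator {..<0} x * f x" 0]
    by (simp add: even indicator_def)
  also have "\<dots> = (\<integral>x. indicator {0..} x * f x \<partial>lborel)"
    using AE_lborel_singleton[of 0] by (intro integral_cong_AE) (auto simp: indicator_def)
  finally have neg: "(\<integral>x. indicator {..<0} x * f x \<partial>lborel) = (\<integral>x. indicator {0..} x * f x \<partial>lborel)" .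
  have "(\<integral>x. f x \<partial>lborel) = (\<integral>x. indicator {..<0} x * f x + indicator {0..} x * f x \<partial>lborel)"
    by (intro Bochner_Integration.integral_cong) (auto simp: indicator_def)
  also have "\<dots> = (\<integral>x. indicator {..<0} x * f x \<partial>lborel) + (\<integral>x. indicator {0..} x * f x \<partial>lborel)"
    by (intro Bochner_Integration.integral_add half) auto
  finally show ?thesis
    by (simp add: neg set_lebesgue_integral_def)
qed

lemma integral_exp_substitution:
  fixes f :: "real \<Rightarrow> real"
  assumes int: "set_integrable lborel {0<..} f" and [measurable]: "f \<in> borel_measurable borel"
      and c: "c > 0"
  shows "integrable lborel (\<lambda>t. c * exp t * f (c * exp t))"
    and "(LINT w:{0<..}|lborel. f w) = (\<integral>t. c * exp t * f (c * exp t) \<partial>lborel)"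
proof -
  have range: "range (\<lambda>t. c * exp t) = {0<..}"
  proof (intro equalityI subsetI)
    fix y :: real assume "y \<in> {0<..}"
    then have "y = c * exp (ln (y / c))" using c by simp
    then show "y \<in> range (\<lambda>t. c * exp t)" by blast
  qed (use c in auto)
  have "f absolutely_integrable_on range (\<lambda>t. c * exp t)"
    using int unfolding range set_integrable_def by (subst integrable_completion) auto
  moreover have "integral (range (\<lambda>t. c * exp t)) f = (LINT w:{0<..}|lborel. f w)"
    using set_borel_integral_eq_integral(2)[OF int] by (simp add: range)
  moreover have "((\<lambda>t. c * exp t) has_field_derivative c * exp t) (at t within UNIV)" for t :: real
    by (auto intro!: derivative_eq_intros)
  moreover have "inj (\<lambda>t. c * exp t)"
    using c by (auto simp: inj_on_def)
  ultimately have *: "(\<lambda>t. \<bar>c * exp t\<bar> *\<^sub>R f (c * exp t)) absolutely_integrable_on UNIV \<and>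
      integral UNIV (\<lambda>t. \<bar>c * exp t\<bar> *\<^sub>R f (c * exp t)) = (LINT w:{0<..}|lborel. f w)"
    by (subst has_absolute_integral_change_of_variables_real) simp_all
  then have "integrable lebesgue (\<lambda>t. c * exp t * f (c * exp t))"
    using c by (simp add: set_integrable_def abs_mult)
  then show I: "integrable lborel (\<lambda>t. c * exp t * f (c * exp t))"
    by (subst (asm) integrable_completion) auto
  then have "set_integrable lborel UNIV (\<lambda>t. c * exp t * f (c * exp t))"
    by (simp add: set_integrable_def)
  from set_borel_integral_eq_integral(2)[OF this] show "(LINT w:{0<..}|lborel. f w)
      = (\<integral>t. c * exp t * f (c * exp t) \<partial>lborel)"
    using * c by (simp add: set_lebesgue_integral_def abs_mult)
qed

text \<open>
  With \<open>w = c e\<^sup>t\<close> and \<open>c = \<bar>h\<bar> / (2 \<surd>\<mu>)\<close> both parts of the exponent \<open>\<mu> w + h\<^sup>2 / (4 w)\<close> get the same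
  coefficient \<open>z / 2\<close>, where \<open>z = \<bar>h\<bar> \<surd>\<mu>\<close>, and together they make \<open>z cosh t\<close>. The remaining factor \<open>exp (\<nu> t)\<close> may be
  replaced by its even part \<open>cosh (\<nu> t)\<close>.
\<close>

lemma bessel_potential_kernel_bessel_K:
  assumes pos: "\<mu> > 0" "a > 0" and h: "h \<noteq> 0"
  shows "bessel_potential_kernel \<mu> a h = 1 / (sqrt pi * Gamma a) *
    (\<bar>h\<bar> / (2 * sqrt \<mu>)) powr (a - 1 / 2) * bessel_K (a - 1 / 2) (\<bar>h\<bar> * sqrt \<mu>)"
proof -
  define \<nu> where "\<nu> = a - 1 / 2"
  define z where "z = \<bar>h\<bar> * sqrt \<mu>"
  define c where "c = \<bar>h\<bar> / (2 * sqrt \<mu>)"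
  define C where "C = 1 / (2 * sqrt pi * Gamma a)"
  have c: "c > 0" using pos h by (simp add: c_def)
  define m where "m t = exp (- z * cosh t) * cosh (\<nu> * t)" for t
  define k where "k t = exp (- z * cosh t) * exp (\<nu> * t)" for t
  have subst_eq: "c * exp t * (gamma_weight \<mu> a (c * exp t) * heat_kernel h (c * exp t))
      = C * c powr \<nu> * k t" for t
  proof -
    define w where "w = c * exp t"
    have w: "w > 0" using c by (simp add: w_def)
    have "\<mu> * w = (z / 2) * exp t"
      using pos by (simp add: w_def c_def z_def field_simps)
    moreover have "h\<^sup>2 / (4 * w) = (z / 2) * exp (- t)"
      using pos h by (simp add: w_def c_def z_def field_simps power2_eq_square exp_minus)
    ultimately have "- \<mu> * w + - (h\<^sup>2) / (4 * w) = - z * cosh t"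
      by (simp add: cosh_def algebra_simps)
    then have e: "exp (- \<mu> * w) * exp (- (h\<^sup>2) / (4 * w)) = exp (- z * cosh t)"
      by (simp only: exp_add[symmetric])
    have "w * (w powr (a - 1) / sqrt w) = w powr 1 * w powr (a - 1) / w powr (1/2)"
      using w by (simp add: powr_half_sqrt)
    also have "\<dots> = w powr (1 + (a - 1) - 1/2)"
      by (simp only: powr_add powr_diff)
    also have "\<dots> = w powr \<nu>"
      by (simp add: \<nu>_def)
    also have "\<dots> = c powr \<nu> * exp (\<nu> * t)"
      using c by (simp add: w_def powr_def ln_mult distrib_left exp_add)
    finally have p: "w * (w powr (a - 1) / sqrt w) = c powr \<nu> * exp (\<nu> * t)" .
    have "w * (gamma_weight \<mu> a w * heat_kernel h w) =
        C * (w * (w powr (a - 1) / sqrt w)) * (exp (- \<mu> * w) * exp (- (h\<^sup>2) / (4 * w)))"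
      by (simp add: gamma_weight_def heat_kernel_def C_def real_sqrt_mult mult_ac)
    also have "\<dots> = C * c powr \<nu> * k t"
      unfolding e p by (simp add: k_def)
    finally show ?thesis by (simp add: w_def)
  qed
  have kint': "integrable lborel (\<lambda>t. C * c powr \<nu> * k t)"
    and res: "bessel_potential_kernel \<mu> a h = (\<integral>t. C * c powr \<nu> * k t \<partial>lborel)"
    using integral_exp_substitution[OF gamma_weight_heat_kernel_integrable[OF pos(2,1), of h] _ c] h
    unfolding subst_eq bessel_potential_kernel_def by simp_all
  have "C * c powr \<nu> \<noteq> 0"
    using c Gamma_real_pos[OF pos(2)] by (simp add: C_def)
  with kint' have kint: "integrable lborel k"
    by (simp del: mult_eq_0_iff)
  have kint_neg: "integrable lborel (\<lambda>t. k (- t))"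
    using lborel_integrable_real_affine[OF kint, of "-1" 0] by simp
  have m_eq: "m = (\<lambda>t. (1 / 2) * k t + (1 / 2) * k (- t))"
    by (simp add: m_def k_def cosh_def fun_eq_iff algebra_simps)
  have mint: "integrable lborel m"
    unfolding m_eq using kint kint_neg by simp
  have "(\<integral>t. k (- t) \<partial>lborel) = (\<integral>t. k t \<partial>lborel)"
    using lborel_integral_real_affine[of "-1" k 0] by simp
  then have "(\<integral>t. k t \<partial>lborel) = (\<integral>t. m t \<partial>lborel)"
    unfolding m_eq using kint kint_neg by simp
  also have "\<dots> = 2 * bessel_K \<nu> z"
    using integral_even[OF mint] by (simp add: m_def bessel_K_def)
  finally have "bessel_potential_kernel \<mu> a h = C * c powr \<nu> * (2 * bessel_K \<nu> z)"
    by (simp add: res)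
  then show ?thesis
    by (simp add: C_def c_def \<nu>_def z_def)
qed

lemma bessel_potential_kernel_gamma_expectation:
  assumes pos: "\<mu> > 0" "a > 0" and W: "distributed N lborel W (gamma_density \<mu> a)"
    and h: "h \<noteq> 0 \<or> a > 1 / 2"
  shows "integrable N (\<lambda>\<omega>. heat_kernel h (W \<omega>))"
    and "(\<integral>\<omega>. heat_kernel h (W \<omega>) \<partial>N) = \<mu> powr a * bessel_potential_kernel \<mu> a h"
proof -
  have nonneg: "gamma_density \<mu> a w \<ge> 0" for w
    using pos by (simp add: gamma_density_def)
  have eq: "gamma_density \<mu> a w * heat_kernel h w = \<mu> powr a *
      (indicator {0<..} w *\<^sub>R (gamma_weight \<mu> a w * heat_kernel h w))" for w
    by (simp add: gamma_density_def gamma_weight_def)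
  have "integrable lborel (\<lambda>w. gamma_density \<mu> a w * heat_kernel h w)"
    unfolding eq using gamma_weight_heat_kernel_integrable[OF pos(2,1) h] by (simp add: set_integrable_def)
  then show "integrable N (\<lambda>\<omega>. heat_kernel h (W \<omega>))"
    using distributed_integrable[OF W, of "heat_kernel h"] nonneg by simp
  have "(\<integral>\<omega>. heat_kernel h (W \<omega>) \<partial>N) = (\<integral>w. gamma_density \<mu> a w * heat_kernel h w \<partial>lborel)"
    using distributed_integral[OF W, of "heat_kernel h"] nonneg by simp
  then show "(\<integral>\<omega>. heat_kernel h (W \<omega>) \<partial>N) = \<mu> powr a * bessel_potential_kernel \<mu> a h"
    unfolding eq by (simp add: bessel_potential_kernel_def set_lebesgue_integral_def)
qed

section \<open>Covariances\<close>

lemma heat_kernel_test_functions_integrable: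
  assumes \<phi>: "\<phi> \<in> test_functions" and \<psi>: "\<psi> \<in> test_functions"
  obtains K where
    "\<And>u. u > 0 \<Longrightarrow> integrable (lborel \<Otimes>\<^sub>M lborel) (\<lambda>(t, s). heat_kernel (t - s) u * (\<phi> t * \<psi> s))"
    "\<And>u. u > 0 \<Longrightarrow> (\<integral>(t, s). heat_kernel (t - s) u * \<bar>\<phi> t * \<psi> s\<bar> \<partial>(lborel \<Otimes>\<^sub>M lborel)) \<le> K"
proof -
  obtain B where [measurable]: "\<psi> \<in> borel_measurable borel" and B: "\<And>x. \<bar>\<psi> x\<bar> \<le> B"
    using test_function_bounded_integrable[OF \<psi>] by metis
  have [measurable]: "\<phi> \<in> borel_measurable borel" and \<phi>_int: "integrable lborel \<phi>"
    using test_function_bounded_integrable[OF \<phi>] by metis+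
  have "B \<ge> 0"
    using B[of 0] by linarith
  have inner: "(\<integral>s. heat_kernel (t - s) u * \<bar>\<phi> t * \<psi> s\<bar> \<partial>lborel) \<le> \<bar>\<phi> t\<bar> * B" if u: "u > 0" for t u
  proof -
    have "(\<integral>s. heat_kernel (t - s) u * \<bar>\<phi> t * \<psi> s\<bar> \<partial>lborel)
        = \<bar>\<phi> t\<bar> * (\<integral>s. heat_kernel (t - s) u * \<bar>\<psi> s\<bar> \<partial>lborel)"
      by (simp add: abs_mult mult.left_commute)
    then show ?thesis
      using heat_kernel_bounded_integrable(2)[OF u _ B, where t = t] by (simp add: mult_left_mono)
  qed
  have joint: "integrable (lborel \<Otimes>\<^sub>M lborel) (\<lambda>(t, s). heat_kernel (t - s) u * (\<phi> t * \<psi> s))"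
      if u: "u > 0" for u
  proof (rule lborel_pair.Fubini_integrable)
    show "integrable lborel (\<lambda>t. \<integral>s. norm (case (t, s) of (t, s) \<Rightarrow> heat_kernel (t - s) u * (\<phi> t * \<psi> s))
        \<partial>lborel)"
    proof (rule Bochner_Integration.integrable_bound)
      show "integrable lborel (\<lambda>t. \<bar>\<phi> t\<bar> * B)"
        using \<phi>_int by simp
      show "AE t in lborel. norm (\<integral>s. norm (case (t, s) of (t, s) \<Rightarrow> heat_kernel (t - s) u *
          (\<phi> t * \<psi> s)) \<partial>lborel) \<le> norm (\<bar>\<phi> t\<bar> * B)"
        using inner[OF u] u \<open>B \<ge> 0\<close> by (intro AE_I2) (simp add: abs_mult heat_kernel_nonneg)
    qed measurable
    show "AE t in lborel. integrable lborel (\<lambda>s. case (t, s) of (t, s) \<Rightarrow> heat_kernel (t - s) u *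
        (\<phi> t * \<psi> s))"
    proof (rule AE_I2)
      fix t
      show "integrable lborel (\<lambda>s. case (t, s) of (t, s) \<Rightarrow> heat_kernel (t - s) u * (\<phi> t * \<psi> s))"
        using integrable_mult_right[OF heat_kernel_bounded_integrable(1)[OF u _ B, where t = t], of "\<phi> t"]
        by (simp add: mult.left_commute)
    qed
  qed measurable
  have "(\<integral>(t, s). heat_kernel (t - s) u * \<bar>\<phi> t * \<psi> s\<bar> \<partial>(lborel \<Otimes>\<^sub>M lborel)) \<le> (\<integral>t. \<bar>\<phi> t\<bar> * B \<partial>lborel)"
      if u: "u > 0" for u
  proof -
    have abs: "integrable (lborel \<Otimes>\<^sub>M lborel) (\<lambda>(t, s). heat_kernel (t - s) u * \<bar>\<phi> t * \<psi> s\<bar>)"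
      using integrable_abs[OF joint[OF u]] u by (simp add: case_prod_beta' abs_mult heat_kernel_nonneg)
    have "(\<integral>(t, s). heat_kernel (t - s) u * \<bar>\<phi> t * \<psi> s\<bar> \<partial>(lborel \<Otimes>\<^sub>M lborel)) =
        (\<integral>t. (\<integral>s. heat_kernel (t - s) u * \<bar>\<phi> t * \<psi> s\<bar> \<partial>lborel) \<partial>lborel)"
      by (rule lborel_pair.integral_fst[OF abs, symmetric])
    also have "\<dots> \<le> (\<integral>t. \<bar>\<phi> t\<bar> * B \<partial>lborel)"
      using \<phi>_int by (intro integral_mono lborel_pair.integrable_fst[OF abs] inner[OF u]) simp
    finally show ?thesis .
  qed
  with joint show ?thesis by (rule that)
qed

context
  fixes M :: "'a measure" and \<sigma> :: real and E :: "(real \<Rightarrow> real) \<Rightarrow> 'a \<Rightarrow> real" and \<mu> \<beta> :: real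
  assumes noise: "gaussian_white_noise M \<sigma> E" and pos: "\<mu> > 0" "\<beta> > 0"
begin

lemma heat_kernel_noise_covariance:
  assumes "w > 0" "w' > 0"
  shows "(\<integral>\<omega>. shift t E (\<lambda>x. heat_kernel x w) \<omega> * shift t' E (\<lambda>x. heat_kernel x w') \<omega> \<partial>M)
    = \<sigma>\<^sup>2 * heat_kernel (t - t') (w + w')"
  using white_noise_covariance[OF noise heat_kernel_L2 heat_kernel_L2, OF assms, of t t'] assms
  by (simp add: shift_def heat_kernel_semigroup)

text \<open>
  The defining property of the mean-square integral, used once for each factor, reduces the covariance
  to a double gamma average of covariances of the noise at two heat kernels.
\<close>

lemma bessel_potential_kernel_noise_covariance:
  assumes \<beta>: "\<beta> > 1 / 4"
  shows "(\<integral>\<omega>. E (\<lambda>s. bessel_potential_kernel \<mu> \<beta> (s - t)) \<omega> *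
      E (\<lambda>s. bessel_potential_kernel \<mu> \<beta> (s - t')) \<omega> \<partial>M)
    = \<sigma>\<^sup>2 * bessel_potential_kernel \<mu> (2 * \<beta>) (t - t')"
proof -
  define X where "X t = E (\<lambda>s. bessel_potential_kernel \<mu> \<beta> (s - t))" for t
  define H where "H t w = shift t E (\<lambda>x. heat_kernel x w)" for t w
  have X_L2: "X t \<in> L2 M" for t
    unfolding X_def by (intro white_noise_L2[OF noise] bessel_potential_kernel_L2[OF pos(1) \<beta>])
  have H_L2: "H t w \<in> L2 M" if "w > 0" for t w
    unfolding H_def shift_def by (intro white_noise_L2[OF noise] heat_kernel_L2 that)
  have X_int: "(\<integral>\<omega>. X t \<omega> * V \<omega> \<partial>M) = (LINT w:{0<..}|lborel. gamma_weight \<mu> \<beta> w * (\<integral>\<omega>. H t w \<omega> * V \<omega> \<partial>M))"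
    if "V \<in> L2 M" for V t
    using has_ms_integral_pairing[OF bessel_potential_kernel_ms_integral[OF pos(1) \<beta> noise] that, of t]
    by (simp add: X_def H_def mult.assoc)
  have HX: "(\<integral>\<omega>. H t w \<omega> * X t' \<omega> \<partial>M) = (LINT w':{0<..}|lborel. gamma_weight \<mu> \<beta> w' *
      (\<sigma>\<^sup>2 * heat_kernel (t - t') (w + w')))"
    if w: "w > 0" for w
  proof -
    have "(\<integral>\<omega>. H t w \<omega> * X t' \<omega> \<partial>M) = (\<integral>\<omega>. X t' \<omega> * H t w \<omega> \<partial>M)"
      by (simp add: mult.commute)
    also have "\<dots> = (LINT w':{0<..}|lborel. gamma_weight \<mu> \<beta> w' * (\<integral>\<omega>. H t' w' \<omega> * H t w \<omega> \<partial>M))"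
      by (rule X_int[OF H_L2[OF w]])
    also have "\<dots> = (LINT w':{0<..}|lborel. gamma_weight \<mu> \<beta> w' * (\<sigma>\<^sup>2 * heat_kernel (t - t') (w + w')))"
      using heat_kernel_noise_covariance[OF _ w, where t = t' and t' = t] heat_kernel_even[of "t - t'"]
      by (intro set_lebesgue_integral_cong) (auto simp: H_def add.commute)
    finally show ?thesis .
  qed
  have int: "set_integrable lborel {0<..} (\<lambda>u. gamma_weight \<mu> (\<beta> + \<beta>) u * (\<sigma>\<^sup>2 * heat_kernel (t - t') u))"
    using set_integrable_mult_right[OF gamma_weight_heat_kernel_integrable[of "2 * \<beta>" \<mu> "t - t'"], of
        "\<sigma>\<^sup>2"] pos \<beta>
    by (simp add: mult_ac)
  have "(\<integral>\<omega>. X t \<omega> * X t' \<omega> \<partial>M) = (LINT w:{0<..}|lborel. gamma_weight \<mu> \<beta> w *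
      (LINT w':{0<..}|lborel. gamma_weight \<mu> \<beta> w' * (\<sigma>\<^sup>2 * heat_kernel (t - t') (w + w'))))"
    unfolding X_int[OF X_L2] by (intro set_lebesgue_integral_cong) (auto simp: HX)
  also have "\<dots> = (LINT u:{0<..}|lborel. gamma_weight \<mu> (\<beta> + \<beta>) u * (\<sigma>\<^sup>2 * heat_kernel (t - t') u))"
    by (rule gamma_weight_convolution[OF pos(2,2,1) _ int]) measurable
  also have "\<dots> = (LINT u:{0<..}|lborel. \<sigma>\<^sup>2 * (gamma_weight \<mu> (2 * \<beta>) u * heat_kernel (t - t') u))"
    by (simp add: mult_ac)
  finally show ?thesis
    by (simp add: X_def bessel_potential_kernel_def)
qed

text \<open>
  As for pointwise values, with the function \<open>P u = \<integral>\<integral> \<phi> t \<psi> s heat_kernel (t - s) u\<close> in place of the heat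
  kernel. The gamma average of \<open>P\<close> is then moved inside the double integral.
\<close>

lemma bessel_potential_noise_covariance:
  assumes \<phi>: "\<phi> \<in> test_functions" and \<psi>: "\<psi> \<in> test_functions"
  shows "integrable (lborel \<Otimes>\<^sub>M lborel) (\<lambda>(t, s). \<phi> t * \<psi> s * bessel_potential_kernel \<mu> (2 * \<beta>) (t - s))"
    and "(\<integral>\<omega>. E (bessel_potential \<mu> \<beta> \<phi>) \<omega> * E (bessel_potential \<mu> \<beta> \<psi>) \<omega> \<partial>M) =
      \<sigma>\<^sup>2 * (\<integral>(t, s). \<phi> t * \<psi> s * bessel_potential_kernel \<mu> (2 * \<beta>) (t - s) \<partial>(lborel \<Otimes>\<^sub>M lborel))"
proof -
  have [measurable]: "\<phi> \<in> borel_measurable borel" "\<psi> \<in> borel_measurable borel"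
    using test_function_bounded_integrable[OF \<phi>] test_function_bounded_integrable[OF \<psi>] by metis+
  obtain K where
    joint: "\<And>u. u > 0 \<Longrightarrow> integrable (lborel \<Otimes>\<^sub>M lborel) (\<lambda>(t, s). heat_kernel (t - s) u * (\<phi> t * \<psi> s))" and
    K: "\<And>u. u > 0 \<Longrightarrow> (\<integral>(t, s). heat_kernel (t - s) u * \<bar>\<phi> t * \<psi> s\<bar> \<partial>(lborel \<Otimes>\<^sub>M lborel)) \<le> K"
    using heat_kernel_test_functions_integrable[OF \<phi> \<psi>] by blast
  define P where "P u = (\<integral>t. \<phi> t * (\<integral>s. \<psi> s * heat_kernel (t - s) u \<partial>lborel) \<partial>lborel)" for u
  have P_eq: "(\<integral>p. heat_kernel (fst p - snd p) u *\<^sub>R (\<phi> (fst p) * \<psi> (snd p)) \<partial>(lborel \<Otimes>\<^sub>M lborel)) = P u"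
      if "u > 0" for u
    using lborel_pair.integral_fst[OF joint[OF that]]
    by (simp add: P_def case_prod_beta' mult_ac)
  have sf: "sigma_finite_measure (lborel \<Otimes>\<^sub>M lborel :: (real \<times> real) measure)"
    by (rule lborel_pair.sigma_finite_measure_axioms)
  note Fubini = bessel_potential_kernel_Fubini[OF pos(1) _ sf, where f = "\<lambda>p. \<phi> (fst p) * \<psi> (snd p)"
      and d = "\<lambda>p. fst p - snd p" and K = K and \<beta> = "2 * \<beta>"]
  have prems: "integrable (lborel \<Otimes>\<^sub>M lborel) (\<lambda>p. heat_kernel (fst p - snd p) u *\<^sub>R (\<phi> (fst p) * \<psi> (snd p)))"
    "(\<integral>p. heat_kernel (fst p - snd p) u * norm (\<phi> (fst p) * \<psi> (snd p)) \<partial>(lborel \<Otimes>\<^sub>M lborel)) \<le> K"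
        if "u > 0" for u
    using joint[OF that] K[OF that] by (simp_all add: case_prod_beta')
  have "integrable (lborel \<Otimes>\<^sub>M lborel) (\<lambda>p. bessel_potential_kernel \<mu> (2 * \<beta>) (fst p - snd p)
      *\<^sub>R (\<phi> (fst p) * \<psi> (snd p)))"
    using pos prems by (intro Fubini(1)) simp_all
  then show "integrable (lborel \<Otimes>\<^sub>M lborel) (\<lambda>(t, s). \<phi> t * \<psi> s * bessel_potential_kernel \<mu> (2 * \<beta>) (t - s))"
    by (simp add: case_prod_beta' mult_ac)
  have "set_integrable lborel {0<..} (\<lambda>u. gamma_weight \<mu> (2 * \<beta>) u *\<^sub>R
      (\<integral>p. heat_kernel (fst p - snd p) u *\<^sub>R (\<phi> (fst p) * \<psi> (snd p)) \<partial>(lborel \<Otimes>\<^sub>M lborel)))"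
    using pos prems by (intro Fubini(2)) simp_all
  then have P_int: "set_integrable lborel {0<..} (\<lambda>u. gamma_weight \<mu> (2 * \<beta>) u * P u)"
    by (rule set_integrable_cong[OF refl refl, THEN iffD1, rotated])
        (simp add: P_eq[unfolded real_scaleR_def])
  have "(\<integral>p. bessel_potential_kernel \<mu> (2 * \<beta>) (fst p - snd p) *\<^sub>R (\<phi> (fst p) * \<psi> (snd p))
      \<partial>(lborel \<Otimes>\<^sub>M lborel)) =
      (LINT u:{0<..}|lborel. gamma_weight \<mu> (2 * \<beta>) u *\<^sub>R
        (\<integral>p. heat_kernel (fst p - snd p) u *\<^sub>R (\<phi> (fst p) * \<psi> (snd p)) \<partial>(lborel \<Otimes>\<^sub>M lborel)))"
    using pos prems by (intro Fubini(3)) simp_all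
  also have "\<dots> = (LINT u:{0<..}|lborel. gamma_weight \<mu> (2 * \<beta>) u * P u)"
    by (intro set_lebesgue_integral_cong) (auto simp: P_eq[unfolded real_scaleR_def])
  finally have P_total: "(LINT u:{0<..}|lborel. gamma_weight \<mu> (2 * \<beta>) u * P u) =
      (\<integral>(t, s). \<phi> t * \<psi> s * bessel_potential_kernel \<mu> (2 * \<beta>) (t - s) \<partial>(lborel \<Otimes>\<^sub>M lborel))"
    by (simp add: case_prod_beta' mult_ac)

  have flow_L2: "E (heat_flow w \<theta>) \<in> L2 M" if "\<theta> \<in> test_functions" "w > 0" for \<theta> w
    by (intro white_noise_L2[OF noise] heat_flow_L2(1) that)
  have power_L2: "E (bessel_potential \<mu> \<beta> \<theta>) \<in> L2 M" if "\<theta> \<in> test_functions" for \<theta>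
    by (intro white_noise_L2[OF noise] bessel_potential_L2[OF pos] that)
  have kernel_L2: "shift t E (\<lambda>x. heat_kernel x w) \<in> L2 M" if "w > 0" for t w
    unfolding shift_def by (intro white_noise_L2[OF noise] heat_kernel_L2 that)
  have flow_pairing: "(\<integral>\<omega>. E (heat_flow w \<theta>) \<omega> * V \<omega> \<partial>M) =
      (\<integral>t. \<theta> t * (\<integral>\<omega>. shift t E (\<lambda>x. heat_kernel x w) \<omega> * V \<omega> \<partial>M) \<partial>lborel)"
    if "\<theta> \<in> test_functions" "w > 0" "V \<in> L2 M" for \<theta> w V
    using has_ms_integral_pairing[OF white_noise_heat_kernel_average[OF noise that(1,2)] that(3)]
    by (simp add: set_lebesgue_integral_def mult.assoc)
  have power_pairing: "(\<integral>\<omega>. E (bessel_potential \<mu> \<beta> \<theta>) \<omega> * V \<omega> \<partial>M) =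
      (LINT w:{0<..}|lborel. gamma_weight \<mu> \<beta> w * (\<integral>\<omega>. E (heat_flow w \<theta>) \<omega> * V \<omega> \<partial>M))"
    if "\<theta> \<in> test_functions" "V \<in> L2 M" for \<theta> V
    using has_ms_integral_pairing[OF bessel_potential_ms_integral[OF pos that(1) noise] that(2)]
    by (simp add: mult.assoc)
  have kernel_flow: "(\<integral>\<omega>. shift t E (\<lambda>x. heat_kernel x w) \<omega> * E (heat_flow w' \<psi>) \<omega> \<partial>M) =
      \<sigma>\<^sup>2 * (\<integral>s. \<psi> s * heat_kernel (t - s) (w + w') \<partial>lborel)" if w: "w > 0" "w' > 0" for t w w'
  proof -
    have "(\<integral>\<omega>. shift t E (\<lambda>x. heat_kernel x w) \<omega> * E (heat_flow w' \<psi>) \<omega> \<partial>M) =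
        (\<integral>\<omega>. E (heat_flow w' \<psi>) \<omega> * shift t E (\<lambda>x. heat_kernel x w) \<omega> \<partial>M)"
      by (simp add: mult.commute)
    also have "\<dots> = (\<integral>s. \<psi> s * (\<sigma>\<^sup>2 * heat_kernel (s - t) (w' + w)) \<partial>lborel)"
      unfolding flow_pairing[OF \<psi> w(2) kernel_L2[OF w(1)]] heat_kernel_noise_covariance[OF w(2,1)] ..
    also have "\<dots> = (\<integral>s. \<sigma>\<^sup>2 * (\<psi> s * heat_kernel (t - s) (w + w')) \<partial>lborel)"
      using heat_kernel_even[of "t - s" "w + w'" for s] by (simp add: add.commute mult.left_commute)
    finally show ?thesis by simp
  qed
  have flow_flow: "(\<integral>\<omega>. E (heat_flow w \<phi>) \<omega> * E (heat_flow w' \<psi>) \<omega> \<partial>M) = \<sigma>\<^sup>2 * P (w + w')"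
    if w: "w > 0" "w' > 0" for w w'
  proof -
    have "(\<integral>\<omega>. E (heat_flow w \<phi>) \<omega> * E (heat_flow w' \<psi>) \<omega> \<partial>M) =
        (\<integral>t. \<sigma>\<^sup>2 * (\<phi> t * (\<integral>s. \<psi> s * heat_kernel (t - s) (w + w') \<partial>lborel)) \<partial>lborel)"
      unfolding flow_pairing[OF \<phi> w(1) flow_L2[OF \<psi> w(2)]] kernel_flow[OF w]
      by (simp only: mult.left_commute[of "\<phi> t" "\<sigma>\<^sup>2" for t])
    then show ?thesis
      by (simp add: P_def)
  qed
  have flow_power: "(\<integral>\<omega>. E (heat_flow w \<phi>) \<omega> * E (bessel_potential \<mu> \<beta> \<psi>) \<omega> \<partial>M) =
      \<sigma>\<^sup>2 * (LINT w':{0<..}|lborel. gamma_weight \<mu> \<beta> w' * P (w + w'))" if w: "w > 0" for w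
  proof -
    have "(\<integral>\<omega>. E (heat_flow w \<phi>) \<omega> * E (bessel_potential \<mu> \<beta> \<psi>) \<omega> \<partial>M) =
        (\<integral>\<omega>. E (bessel_potential \<mu> \<beta> \<psi>) \<omega> * E (heat_flow w \<phi>) \<omega> \<partial>M)"
      by (simp add: mult.commute)
    also have "\<dots> = (LINT w':{0<..}|lborel. gamma_weight \<mu> \<beta> w' *
        (\<integral>\<omega>. E (heat_flow w' \<psi>) \<omega> * E (heat_flow w \<phi>) \<omega> \<partial>M))"
      by (rule power_pairing[OF \<psi> flow_L2[OF \<phi> w]])
    also have "\<dots> = (LINT w':{0<..}|lborel. \<sigma>\<^sup>2 * (gamma_weight \<mu> \<beta> w' * P (w + w')))"
      using flow_flow[OF w] by (intro set_lebesgue_integral_cong)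
          (auto simp: mult.commute mult.left_commute)
    finally show ?thesis by simp
  qed
  have "(\<integral>\<omega>. E (bessel_potential \<mu> \<beta> \<phi>) \<omega> * E (bessel_potential \<mu> \<beta> \<psi>) \<omega> \<partial>M) =
      (LINT w:{0<..}|lborel. \<sigma>\<^sup>2 * (gamma_weight \<mu> \<beta> w * (LINT w':{0<..}|lborel. gamma_weight \<mu> \<beta> w' *
          P (w + w'))))"
    unfolding power_pairing[OF \<phi> power_L2[OF \<psi>]]
    by (intro set_lebesgue_integral_cong) (auto simp: flow_power)
  also have "\<dots> = \<sigma>\<^sup>2 * (LINT w:{0<..}|lborel. gamma_weight \<mu> \<beta> w *
      (LINT w':{0<..}|lborel. gamma_weight \<mu> \<beta> w' * P (w + w')))"
    by simp
  also have "(LINT w:{0<..}|lborel. gamma_weight \<mu> \<beta> w * (LINT w':{0<..}|lborel. gamma_weight \<mu> \<beta> w' *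
      P (w + w'))) =
      (LINT u:{0<..}|lborel. gamma_weight \<mu> (2 * \<beta>) u * P u)"
  proof -
    have [measurable]: "P \<in> borel_measurable borel"
      unfolding P_def[abs_def] by measurable
    show ?thesis
      using gamma_weight_convolution[of \<beta> \<beta> \<mu> P] pos P_int by simp
  qed
  finally show "(\<integral>\<omega>. E (bessel_potential \<mu> \<beta> \<phi>) \<omega> * E (bessel_potential \<mu> \<beta> \<psi>) \<omega> \<partial>M) =
      \<sigma>\<^sup>2 * (\<integral>(t, s). \<phi> t * \<psi> s * bessel_potential_kernel \<mu> (2 * \<beta>) (t - s) \<partial>(lborel \<Otimes>\<^sub>M lborel))"
    unfolding P_total .
qed

end

section \<open>Solutions\<close>

lemma gamma_weight_times: "1 / Gamma a * (w powr (a - 1) * exp (- \<mu> * w) * y) = gamma_weight \<mu> a w * y"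
  by (simp add: gamma_weight_def)

context
  fixes M :: "'a measure" and \<sigma> :: real and E :: "(real \<Rightarrow> real) \<Rightarrow> 'a \<Rightarrow> real" and \<mu> \<beta> :: real
  assumes noise: "gaussian_white_noise M \<sigma> E" and pos: "\<mu> > 0" "\<beta> > 0"
begin

lemma solution_exists: "is_solution M \<mu> \<beta> E (\<lambda>\<phi>. E (bessel_potential \<mu> \<beta> \<phi>))"
  unfolding is_solution_def is_heat_semigroup_def gamma_weight_times
  using white_noise_heat_semigroup[OF noise] bessel_potential_ms_integral[OF pos _ noise]
  by (intro exI[of _ "\<lambda>w \<phi>. E (heat_flow w \<phi>)"]) simp

text \<open>
  Both integrals in the definition of a solution determine their values up to null sets.
\<close>

lemma solution_eq_noise_bessel_potential:
  assumes sol: "is_solution M \<mu> \<beta> E X" and \<phi>: "\<phi> \<in> test_functions"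
  shows "X \<phi> \<in> L2 M" and "AE \<omega> in M. X \<phi> \<omega> = E (bessel_potential \<mu> \<beta> \<phi>) \<omega>"
proof -
  obtain Y where Y: "\<And>w. w > 0 \<Longrightarrow> has_ms_integral M UNIV (\<lambda>x \<omega>. heat_kernel x w * shift x E \<phi> \<omega>) (Y w \<phi>)"
    and X: "has_ms_integral M {0<..} (\<lambda>w \<omega>. gamma_weight \<mu> \<beta> w * Y w \<phi> \<omega>) (X \<phi>)"
    using sol \<phi> unfolding is_solution_def is_heat_semigroup_def gamma_weight_times by blast
  show L2: "X \<phi> \<in> L2 M"
    using X by (simp add: has_ms_integral_def)
  have "has_ms_integral M {0<..} (\<lambda>w \<omega>. gamma_weight \<mu> \<beta> w * E (heat_flow w \<phi>) \<omega>) (X \<phi>)"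
  proof (rule has_ms_integral_cong_AE[OF X])
    fix w :: real assume "w \<in> {0<..}"
    then have w: "w > 0" by simp
    show "(\<lambda>\<omega>. gamma_weight \<mu> \<beta> w * E (heat_flow w \<phi>) \<omega>) \<in> L2 M"
      by (intro L2_scale white_noise_L2[OF noise] heat_flow_L2(1)[OF \<phi> w])
    show "AE \<omega> in M. gamma_weight \<mu> \<beta> w * E (heat_flow w \<phi>) \<omega> = gamma_weight \<mu> \<beta> w * Y w \<phi> \<omega>"
      using has_ms_integral_unique[OF white_noise_heat_semigroup[OF noise \<phi> w] Y[OF w]] by auto
  qed (use L2 in auto)
  then show "AE \<omega> in M. X \<phi> \<omega> = E (bessel_potential \<mu> \<beta> \<phi>) \<omega>"
    using bessel_potential_ms_integral[OF pos \<phi> noise] by (rule has_ms_integral_unique)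
qed

lemma solution_represented_weakly:
  assumes sol: "is_solution M \<mu> \<beta> E X" and \<phi>: "\<phi> \<in> test_functions"
  shows "represented_weakly M \<mu> \<beta> E \<phi> (X \<phi>)"
proof -
  have "has_ms_integral M {0<..} (\<lambda>w \<omega>. gamma_weight \<mu> \<beta> w * E (heat_flow w \<phi>) \<omega>) (X \<phi>)"
  proof (rule has_ms_integral_cong_AE[OF bessel_potential_ms_integral[OF pos \<phi> noise]])
    show "(\<lambda>\<omega>. gamma_weight \<mu> \<beta> w * E (heat_flow w \<phi>) \<omega>) \<in> L2 M" if "w \<in> {0<..}" for w
      using that by (intro L2_scale white_noise_L2[OF noise] heat_flow_L2(1)[OF \<phi>]) simp
  qed (use solution_eq_noise_bessel_potential[OF sol \<phi>] in auto)
  then show ?thesis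
    unfolding represented_weakly_def gamma_weight_times
    using white_noise_heat_kernel_average[OF noise \<phi>] by (intro exI[of _ "\<lambda>w. E (heat_flow w \<phi>)"]) simp
qed

lemma represented_at_bessel_potential_kernel:
  assumes "\<beta> > 1 / 4"
  shows "represented_at M \<mu> \<beta> E t (E (\<lambda>s. bessel_potential_kernel \<mu> \<beta> (s - t)))"
  unfolding represented_at_def gamma_weight_times
  by (rule bessel_potential_kernel_ms_integral[OF pos(1) assms noise])

lemma represented_at_unique:
  assumes "\<beta> > 1 / 4" and Z: "represented_at M \<mu> \<beta> E t Z"
  shows "Z \<in> L2 M" and "AE \<omega> in M. Z \<omega> = E (\<lambda>s. bessel_potential_kernel \<mu> \<beta> (s - t)) \<omega>"
proof -
  show "Z \<in> L2 M"
    using Z by (simp add: represented_at_def has_ms_integral_def)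
  show "AE \<omega> in M. Z \<omega> = E (\<lambda>s. bessel_potential_kernel \<mu> \<beta> (s - t)) \<omega>"
    using Z represented_at_bessel_potential_kernel[OF assms(1)]
    unfolding represented_at_def by (rule has_ms_integral_unique)
qed

text \<open>
  The integral over \<open>t\<close> of the noise at the kernels centred at \<open>t\<close> is the noise at the convolution of \<open>\<phi>\<close>
  with the kernel, which is the Bessel potential of \<open>\<phi>\<close>.
\<close>

lemma solution_integral_of_pointwise:
  assumes \<beta>: "\<beta> > 1 / 4" and sol: "is_solution M \<mu> \<beta> E X" and \<phi>: "\<phi> \<in> test_functions"
  shows "has_ms_integral M UNIV (\<lambda>t \<omega>. \<phi> t * E (\<lambda>s. bessel_potential_kernel \<mu> \<beta> (s - t)) \<omega>) (X \<phi>)"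
proof -
  have [measurable]: "\<phi> \<in> borel_measurable borel" and int: "integrable lborel \<phi>"
    using test_function_bounded_integrable[OF \<phi>] by metis+
  have L2: "(\<lambda>s. bessel_potential_kernel \<mu> \<beta> (s - t)) \<in> L2 lborel" for t
    by (rule bessel_potential_kernel_L2[OF pos(1) \<beta>])
  have norm: "norm2 lborel (\<lambda>s. bessel_potential_kernel \<mu> \<beta> (s - t))
      = norm2 lborel (bessel_potential_kernel \<mu> \<beta>)" for t
    using L2[of 0] by (intro L2_translate(2)) simp
  have "has_ms_integral M UNIV (\<lambda>t \<omega>. \<phi> t * E (\<lambda>s. bessel_potential_kernel \<mu> \<beta> (s - t)) \<omega>)
      (E (\<lambda>s. LINT t:UNIV|lborel. \<phi> t * bessel_potential_kernel \<mu> \<beta> (s - t)))"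
  proof (rule white_noise_weighted_ms_integral[OF noise])
    show "set_integrable lborel UNIV (\<lambda>t. \<bar>\<phi> t\<bar> * norm2 lborel (\<lambda>s. bessel_potential_kernel \<mu> \<beta> (s - t)))"
      using int by (simp add: norm set_integrable_def)
  qed (use L2 in measurable)
  then have pointwise: "has_ms_integral M UNIV (\<lambda>t \<omega>. \<phi> t * E (\<lambda>s. bessel_potential_kernel \<mu> \<beta> (s - t))
      \<omega>) (E (bessel_potential \<mu> \<beta> \<phi>))"
    by (simp add: set_lebesgue_integral_def bessel_potential_eq_convolution[OF pos \<phi>, abs_def])
  show ?thesis
  proof (rule has_ms_integral_cong_AE[OF pointwise])
    show "(\<lambda>\<omega>. \<phi> t * E (\<lambda>s. bessel_potential_kernel \<mu> \<beta> (s - t)) \<omega>) \<in> L2 M" for t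
      by (intro L2_scale white_noise_L2[OF noise] L2)
  qed (use solution_eq_noise_bessel_potential[OF sol \<phi>] in auto)
qed

lemma solution_generalized_covariance:
  assumes sol: "is_solution M \<mu> \<beta> E X"
  shows "has_generalized_covariance M X (\<lambda>h. \<sigma>\<^sup>2 * bessel_potential_kernel \<mu> (2 * \<beta>) h)"
  unfolding has_generalized_covariance_def
proof (intro conjI ballI)
  fix \<phi> assume \<phi>: "\<phi> \<in> test_functions"
  have power_L2: "E (bessel_potential \<mu> \<beta> \<theta>) \<in> L2 M" if "\<theta> \<in> test_functions" for \<theta>
    by (intro white_noise_L2[OF noise] bessel_potential_L2[OF pos] that)
  note X = solution_eq_noise_bessel_potential[OF sol]
  note cong = expectation_cong_AE[OF X(1) power_L2 X(1) power_L2 X(2) X(2)]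
  show "X \<phi> \<in> L2 M" by (rule X(1)[OF \<phi>])
  show "(\<integral>\<omega>. X \<phi> \<omega> \<partial>M) = 0"
    using cong(1)[OF \<phi> \<phi> \<phi> \<phi> \<phi> \<phi>] white_noise_mean[OF noise bessel_potential_L2[OF pos \<phi>]] by simp
  fix \<psi> assume \<psi>: "\<psi> \<in> test_functions"
  note cov = bessel_potential_noise_covariance[OF noise pos \<phi> \<psi>]
  have eq: "(\<lambda>(t, s). \<phi> t * \<psi> s * (\<sigma>\<^sup>2 * bessel_potential_kernel \<mu> (2 * \<beta>) (t - s))) =
      (\<lambda>p. \<sigma>\<^sup>2 * (case p of (t, s) \<Rightarrow> \<phi> t * \<psi> s * bessel_potential_kernel \<mu> (2 * \<beta>) (t - s)))"
    by (auto simp: mult_ac)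
  show "integrable (lborel \<Otimes>\<^sub>M lborel) (\<lambda>(t, s). \<phi> t * \<psi> s *
      (\<sigma>\<^sup>2 * bessel_potential_kernel \<mu> (2 * \<beta>) (t - s)))"
    unfolding eq using cov(1) by (rule integrable_mult_right)
  show "(\<integral>\<omega>. X \<phi> \<omega> * X \<psi> \<omega> \<partial>M) =
      (\<integral>(t, s). \<phi> t * \<psi> s * (\<sigma>\<^sup>2 * bessel_potential_kernel \<mu> (2 * \<beta>) (t - s)) \<partial>(lborel \<Otimes>\<^sub>M lborel))"
    unfolding eq using cong(2)[OF \<phi> \<phi> \<psi> \<psi> \<phi> \<psi>] cov(2) by simp
qed

lemma pointwise_solution_covariance:
  assumes \<beta>: "\<beta> > 1 / 4" and X': "\<And>t. represented_at M \<mu> \<beta> E t (X' t)"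
  shows "has_covariance M X' (\<lambda>h. \<sigma>\<^sup>2 * bessel_potential_kernel \<mu> (2 * \<beta>) h)"
  unfolding has_covariance_def
proof (intro conjI allI)
  note kernel_L2 = bessel_potential_kernel_L2[OF pos(1) \<beta>]
  note X = represented_at_unique[OF \<beta> X']
  note E_L2 = white_noise_L2[OF noise kernel_L2]
  note cong = expectation_cong_AE[OF X(1) E_L2 X(1) E_L2 X(2) X(2)]
  fix t h
  show "X' t \<in> L2 M" by (rule X(1))
  show "(\<integral>\<omega>. X' t \<omega> \<partial>M) = 0"
    using cong(1) white_noise_mean[OF noise kernel_L2] by simp
  show "(\<integral>\<omega>. X' (t + h) \<omega> * X' t \<omega> \<partial>M) = \<sigma>\<^sup>2 * bessel_potential_kernel \<mu> (2 * \<beta>) h"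
    using cong(2)[of "t + h" t] bessel_potential_kernel_noise_covariance[OF noise pos \<beta>, of "t + h" t]
        by simp
qed

end

theorem theorem3p1:
  fixes M :: "'a measure" and E :: "(real \<Rightarrow> real) \<Rightarrow> 'a \<Rightarrow> real"
    and N :: "'b measure" and W :: "'b \<Rightarrow> real"
    and \<sigma> \<mu> \<beta> :: real
  assumes noise: "gaussian_white_noise M \<sigma> E"
    and pos: "\<mu> > 0" "\<beta> > 0"
    and gamma: "prob_space N" "distributed N lborel W (gamma_density \<mu> (2 * \<beta>))"
  shows "(\<exists>X. is_solution M \<mu> \<beta> E X) \<and>
         (\<forall>X. is_solution M \<mu> \<beta> E X \<longrightarrow>
           (\<forall>\<phi>\<in>test_functions. represented_weakly M \<mu> \<beta> E \<phi> (X \<phi>)) \<and>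
           (\<beta> > 1 / 4 \<longrightarrow>
             (\<exists>X'. (\<forall>t. represented_at M \<mu> \<beta> E t (X' t)) \<and>
                (\<forall>\<phi>\<in>test_functions. has_ms_integral M UNIV (\<lambda>t \<omega>. \<phi> t * X' t \<omega>) (X \<phi>))))) \<and>
         (\<exists>Cov.
           (\<forall>X. is_solution M \<mu> \<beta> E X \<longrightarrow> has_generalized_covariance M X Cov) \<and>
           (\<beta> > 1 / 4 \<longrightarrow>
             (\<forall>X'. (\<forall>t. represented_at M \<mu> \<beta> E t (X' t)) \<longrightarrow> has_covariance M X' Cov)) \<and>
           integrable lborel Cov \<and>
           (\<forall>\<tau>. spectral_function Cov \<tau> = complex_of_real (\<sigma>\<^sup>2 / (\<mu> + \<tau>\<^sup>2) powr (2 * \<beta>))) \<and>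
           (\<forall>h. h \<noteq> 0 \<or> \<beta> > 1 / 4 \<longrightarrow>
              integrable N (\<lambda>\<omega>. exp (- (h\<^sup>2) / (4 * W \<omega>)) / (2 * sqrt (pi * W \<omega>))) \<and>
              Cov h = \<sigma>\<^sup>2 / \<mu> powr (2 * \<beta>) *
                (\<integral>\<omega>. exp (- (h\<^sup>2) / (4 * W \<omega>)) / (2 * sqrt (pi * W \<omega>)) \<partial>N)) \<and>
           (\<forall>h. h \<noteq> 0 \<longrightarrow>
              Cov h = \<sigma>\<^sup>2 / (sqrt pi * Gamma (2 * \<beta>)) *
                (\<bar>h\<bar> / (2 * sqrt \<mu>)) powr (2 * \<beta> - 1 / 2) *
                bessel_K (2 * \<beta> - 1 / 2) (\<bar>h\<bar> * sqrt \<mu>)) \<and>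
           (\<beta> > 1 / 4 \<longrightarrow>
              ((\<lambda>h. \<sigma>\<^sup>2 / (sqrt pi * Gamma (2 * \<beta>)) *
                (\<bar>h\<bar> / (2 * sqrt \<mu>)) powr (2 * \<beta> - 1 / 2) *
                bessel_K (2 * \<beta> - 1 / 2) (\<bar>h\<bar> * sqrt \<mu>)) \<longlongrightarrow> Cov 0) (at 0)))"
proof -
  define Cov where "Cov h = \<sigma>\<^sup>2 * bessel_potential_kernel \<mu> (2 * \<beta>) h" for h
  have pos2: "2 * \<beta> > 0"
    using pos by simp
  have bessel: "Cov h = \<sigma>\<^sup>2 / (sqrt pi * Gamma (2 * \<beta>)) *
      (\<bar>h\<bar> / (2 * sqrt \<mu>)) powr (2 * \<beta> - 1 / 2) * bessel_K (2 * \<beta> - 1 / 2) (\<bar>h\<bar> * sqrt \<mu>)" if "h \<noteq> 0" for h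
    by (simp add: Cov_def bessel_potential_kernel_bessel_K[OF pos(1) pos2 that])
  have W: "exp (- (h\<^sup>2) / (4 * W \<omega>)) / (2 * sqrt (pi * W \<omega>)) = heat_kernel h (W \<omega>)" for h \<omega>
    by (simp add: heat_kernel_def real_sqrt_mult)
  have gamma_expectation: "integrable N (\<lambda>\<omega>. heat_kernel h (W \<omega>)) \<and>
      Cov h = \<sigma>\<^sup>2 / \<mu> powr (2 * \<beta>) * (\<integral>\<omega>. heat_kernel h (W \<omega>) \<partial>N)" if "h \<noteq> 0 \<or> \<beta> > 1 / 4" for h
    using bessel_potential_kernel_gamma_expectation[OF pos(1) pos2 gamma(2), of h] that pos
        by (auto simp: Cov_def)
  have spectral: "spectral_function Cov \<tau> = complex_of_real (\<sigma>\<^sup>2 / (\<mu> + \<tau>\<^sup>2) powr (2 * \<beta>))" for \<tau>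
    using bessel_potential_kernel_Fourier[OF pos(1) pos2, of \<tau>]
    by (simp add: spectral_function_def Cov_def mult.left_commute powr_minus_divide)
  have limit: "((\<lambda>h. \<sigma>\<^sup>2 / (sqrt pi * Gamma (2 * \<beta>)) * (\<bar>h\<bar> / (2 * sqrt \<mu>)) powr (2 * \<beta> - 1 / 2) *
      bessel_K (2 * \<beta> - 1 / 2) (\<bar>h\<bar> * sqrt \<mu>)) \<longlongrightarrow> Cov 0) (at 0)" if \<beta>: "\<beta> > 1 / 4"
  proof (rule Lim_transform_eventually)
    show "(Cov \<longlongrightarrow> Cov 0) (at 0)"
      unfolding Cov_def[abs_def] using pos \<beta>
      by (intro tendsto_mult_left bessel_potential_kernel_continuous_at_zero) auto
    show "\<forall>\<^sub>F h in at 0. Cov h = \<sigma>\<^sup>2 / (sqrt pi * Gamma (2 * \<beta>)) * (\<bar>h\<bar> / (2 * sqrt \<mu>)) powr (2 * \<beta> - 1 / 2) *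
        bessel_K (2 * \<beta> - 1 / 2) (\<bar>h\<bar> * sqrt \<mu>)"
      unfolding eventually_at_filter using bessel by (intro always_eventually) blast
  qed
  have covariance: "has_generalized_covariance M X Cov" if "is_solution M \<mu> \<beta> E X" for X
    using solution_generalized_covariance[OF noise pos that] by (simp add: Cov_def[abs_def])
  have pointwise_covariance: "has_covariance M X' Cov" if "\<beta> > 1 / 4" "\<forall>t. represented_at M \<mu>
      \<beta> E t (X' t)" for X'
    using pointwise_solution_covariance[OF noise pos that(1), of X'] that(2) by (simp add: Cov_def[abs_def])
  have Cov_integrable: "integrable lborel Cov"
    using bessel_potential_kernel_integrable[OF pos(1) pos2] by (simp add: Cov_def[abs_def])
  show ?thesis
  proof (intro conjI)
    show "\<exists>X. is_solution M \<mu> \<beta> E X"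
      using solution_exists[OF noise pos] by blast
    show "\<forall>X. is_solution M \<mu> \<beta> E X \<longrightarrow>
           (\<forall>\<phi>\<in>test_functions. represented_weakly M \<mu> \<beta> E \<phi> (X \<phi>)) \<and>
           (\<beta> > 1 / 4 \<longrightarrow>
             (\<exists>X'. (\<forall>t. represented_at M \<mu> \<beta> E t (X' t)) \<and>
                (\<forall>\<phi>\<in>test_functions. has_ms_integral M UNIV (\<lambda>t \<omega>. \<phi> t * X' t \<omega>) (X \<phi>))))"
    proof (intro allI impI conjI ballI exI[of _ "\<lambda>t. E (\<lambda>s. bessel_potential_kernel \<mu> \<beta> (s - t))"])
    qed (use solution_represented_weakly[OF noise pos] represented_at_bessel_potential_kernel[OF noise pos]
        solution_integral_of_pointwise[OF noise pos] in simp_all)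
  qed (unfold W, intro exI[of _ Cov] conjI allI impI;
      use covariance pointwise_covariance Cov_integrable spectral gamma_expectation bessel limit in blast)
qed

end
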